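(* Let $d\ge2$, let $M$ be the uncentered maximal operator on $\mathbb{R}^d$ associated to balls defined by the $\ell_1$ norm (cross-polytopes), and let $\omega$ be a modulus of continuity. Then $$\|M\|_{\operatorname{Op}(\omega)}=\sup_{t>0}\ \inf_{1/2\le R\le1}\frac{d(d-1)}{2\,\omega(t)}\int_{-1}^1\int_0^{1-|u_1|}\omega\big(t(|(1-R)+Ru_1|+R\rho)\big)\rho^{d-2}\,d\rho\,du_1 .$$ If the same modulus $\omega$ is chosen in all dimensions, then $\lim_{d\to\infty}\|M\|_{\operatorname{Op}(\omega)}=1$.
   Context: On $\mathbb{R}^d$ with the norm $\|\cdot\|_1$, the uncentered Hardy-Littlewood maximal function of a locally integrable $f:\mathbb{R}^d\to\mathbb{R}$ is $Mf(x)=\sup_{B\ni x}\frac1{|B|}\int_B|f(y)|\,dy\in[0,\infty]$, the supremum being over all $\ell_1$ balls $B$ (of positive finite radius) containing $x$; $|B|$ is Lebesgue measure. A modulus of continuity is a function $\omega:[0,\infty)\to[0,\infty)$ that is continuous, nondecreasing, subadditive, with $\omega(0)=0$, and not identically zero. For $f:\mathbb{R}^d\to\mathbb{R}$ let $\|f\|_{\operatorname{Lip}(\omega)}=\sup_{x\ne y}\frac{|f(x)-f(y)|}{\omega(\|x-y\|_1)}$; $\operatorname{Lip}(\omega)$ consists of the $f$ for which this is finite, and $$\|M\|_{\operatorname{Op}(\omega)}=\sup\Big\{\frac{\|Mf\|_{\operatorname{Lip}(\omega)}}{\|f\|_{\operatorname{Lip}(\omega)}}: f\in\operatorname{Lip}(\omega),\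 \|f\|_{\operatorname{Lip}(\omega)}\ne0\Big\}.$$ If $Mf\equiv\infty$, it is regarded as constant, i.e. $\|Mf\|_{\operatorname{Lip}(\omega)}=0$. *)

theory Defs
  imports "HOL-Analysis.Analysis"
begin

text \<open>
  The second claim lets the dimension tend to infinity, so \<open>d\<close> has to be a natural number
  rather than a type: a point of d-dimensional space is an extensional function on \<open>{..<d}\<close>,
  and Lebesgue measure is the d-fold product of \<^const>\<open>lborel\<close>.
\<close>

definition Rd :: "nat \<Rightarrow> (nat \<Rightarrow> real) set" where
  "Rd d = ({..<d} \<rightarrow>\<^sub>E UNIV)"

definition lebesgue_Rd :: "nat \<Rightarrow> (nat \<Rightarrow> real) measure" where
  "lebesgue_Rd d = Pi\<^sub>M {..<d} (\<lambda>_. lborel)"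

definition l1_norm :: "nat \<Rightarrow> (nat \<Rightarrow> real) \<Rightarrow> real" where
  "l1_norm d x = (\<Sum>i<d. \<bar>x i\<bar>)"

definition l1_ball :: "nat \<Rightarrow> (nat \<Rightarrow> real) \<Rightarrow> real \<Rightarrow> (nat \<Rightarrow> real) set" where
  "l1_ball d c r = {y \<in> Rd d. l1_norm d (\<lambda>i. y i - c i) \<le> r}"

definition maximal_fun :: "nat \<Rightarrow> ((nat \<Rightarrow> real) \<Rightarrow> real) \<Rightarrow> (nat \<Rightarrow> real) \<Rightarrow> ennreal" where
  "maximal_fun d f x =
    (SUP B \<in> {l1_ball d c r | c r. c \<in> Rd d \<and> 0 < r \<and> x \<in> l1_ball d c r}.
       (\<integral>\<^sup>+ y \<in> B. ennreal \<bar>f y\<bar> \<partial>lebesgue_Rd d) / emeasure (lebesgue_Rd d) B)"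

text \<open>Only the values of \<open>\<omega>\<close> on \<open>{0..}\<close> are constrained, and only these are ever used.\<close>

definition modulus_of_continuity :: "(real \<Rightarrow> real) \<Rightarrow> bool" where
  "modulus_of_continuity \<omega> \<longleftrightarrow>
     continuous_on {0..} \<omega> \<and> (\<forall>t\<ge>0. 0 \<le> \<omega> t) \<and> mono_on {0..} \<omega> \<and>
     (\<forall>s\<ge>0. \<forall>t\<ge>0. \<omega> (s + t) \<le> \<omega> s + \<omega> t) \<and> \<omega> 0 = 0 \<and> (\<exists>t\<ge>0. \<omega> t \<noteq> 0)"

text \<open>
  The argument is extended-real-valued so that the definition covers both a real function and its
  maximal function. A function that is identically infinite counts as constant. If \<open>g\<close> takes
  both finite and infinite values, the supremum is infinite; note that \<open>\<infinity> - \<infinity> = \<infinity>\<close>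
  in \<^typ>\<open>ereal\<close>. For a modulus of continuity \<open>\<omega>\<close> the denominators are positive.
\<close>

definition lip_norm :: "nat \<Rightarrow> (real \<Rightarrow> real) \<Rightarrow> ((nat \<Rightarrow> real) \<Rightarrow> ereal) \<Rightarrow> ereal" where
  "lip_norm d \<omega> g =
    (if \<forall>x\<in>Rd d. g x = \<infinity> then 0
     else SUP (x, y) \<in> {(x, y). x \<in> Rd d \<and> y \<in> Rd d \<and> x \<noteq> y}.
            \<bar>g x - g y\<bar> / ereal (\<omega> (l1_norm d (\<lambda>i. x i - y i))))"

definition Lip :: "nat \<Rightarrow> (real \<Rightarrow> real) \<Rightarrow> ((nat \<Rightarrow> real) \<Rightarrow> real) set" where
  "Lip d \<omega> = {f. lip_norm d \<omega> (\<lambda>x. ereal (f x)) < \<infinity>}"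

definition maximal_op_norm :: "nat \<Rightarrow> (real \<Rightarrow> real) \<Rightarrow> ereal" where
  "maximal_op_norm d \<omega> =
    (SUP f \<in> {f \<in> Lip d \<omega>. lip_norm d \<omega> (\<lambda>x. ereal (f x)) \<noteq> 0}.
       lip_norm d \<omega> (\<lambda>x. enn2ereal (maximal_fun d f x)) / lip_norm d \<omega> (\<lambda>x. ereal (f x)))"

end

theory Submission
  imports Defs
begin

text \<open>
  For \<open>x\<close>, \<open>y\<close> at distance \<open>t\<close>, every ball containing \<open>x\<close> is mapped affinely onto a larger ball
  containing \<open>y\<close> in such a way that the displacement is uniformly distributed on the ball with
  center \<open>(1 - R) (y - x)\<close> and radius \<open>t R\<close>. So \<open>Mf(x) - Mf(y)\<close> is at most the average over that
  ball of \<open>\<omega>(|z|)\<close>, where \<open>R\<close> is free. Among centers of given norm this average is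
  largest on a coordinate axis: two coordinates can be merged into one, because in a plane a
  rotation turns the \<open>\<ell>\<^sub>1\<close> norm into the maximum norm, for which both bodies are squares and only the
  distance between two intervals grows. Conversely, among all balls containing \<open>t e\<^sub>1\<close> the average
  of an increasing function of the norm is smallest on a ball with center \<open>t (1 - R) e\<^sub>1\<close> and
  radius \<open>t R\<close>, \<open>1/2 \<le> R \<le> 1\<close>, which makes the truncated cone \<open>\<omega>(t) - min(\<omega>(|z|), \<omega>(t))\<close>
  extremal. As \<open>d\<close> grows, the norm concentrates at \<open>t\<close> on these balls, uniformly in \<open>R\<close>.
\<close>

section \<open>Averages over l1 balls as functions of the center\<close>

text \<open>The average of \<open>\<omega>(|z|)\<close> over an l1 ball depends on the direction of
  its center, so transporting balls alone bounds \<open>Mf(x) - Mf(y)\<close> by a quantity that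
  varies with the direction of \<open>y - x\<close>, while the lower bound is computed along an
  axis. The comparison of all centers with those on the axis closes this gap. The two sides then
  meet because the same balls, with center \<open>t (1 - R) e_1\<close> and radius
  \<open>t R\<close>, occur in two roles: as sets of displacements in the upper bound, where
  \<open>R\<close> may be chosen at will, and as the balls containing \<open>t e_1\<close> that
  matter for \<open>Mf(t e_1)\<close>, where the supremum over balls selects \<open>R\<close>. This
  is why an infimum over \<open>R\<close> appears on both sides.

  All averages are pulled back to the unit ball, of volume \<open>2 ^ d / fact d\<close>. Splitting
  off one coordinate and using polar coordinates in the others leaves the weight
  \<open>\<rho> ^ (d - 2)\<close> on the triangle \<open>\<bar>u\<bar> + \<rho> \<le> 1\<close>; the
  quotient of the two constants is \<open>d (d - 1) / 2\<close>. For the normalized weight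
  \<open>1 - \<rho>\<close> has mean \<open>2 / (d + 1)\<close>, which drives the limit.\<close>

interpretation lborel_family: product_sigma_finite "\<lambda>_. lborel :: real measure"
  by standard

text \<open>The rescaled image of the product measure under the affine map is compared with the
  product measure on boxes, where the one-dimensional substitution applies in each coordinate.
  Agreement on boxes determines the measure.\<close>

lemma nn_integral_PiM_lborel_affine:
  fixes c :: "'i \<Rightarrow> real"
  assumes I: "finite I" and r: "0 < r"
    and g [measurable]: "g \<in> borel_measurable (Pi\<^sub>M I (\<lambda>_. lborel))"
  shows "(\<integral>\<^sup>+x. g x \<partial>Pi\<^sub>M I (\<lambda>_. lborel)) =
    ennreal (r ^ card I) * (\<integral>\<^sup>+u. g (\<lambda>i\<in>I. c i + r * u i) \<partial>Pi\<^sub>M I (\<lambda>_. lborel))"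
proof -
  define L where "L = Pi\<^sub>M I (\<lambda>_. lborel :: real measure)"
  define T where "T = (\<lambda>u. \<lambda>i\<in>I. c i + r * u i)"
  have T [measurable]: "T \<in> L \<rightarrow>\<^sub>M L"
    unfolding T_def L_def by measurable
  have "density (distr L L T) (\<lambda>_. ennreal (r ^ card I)) = Pi\<^sub>M I (\<lambda>_. lborel)"
  proof (rule lborel_family.PiM_eqI[OF I])
    show "sets (density (distr L L T) (\<lambda>_. ennreal (r ^ card I))) = sets (Pi\<^sub>M I (\<lambda>_. lborel))"
      by (simp add: L_def)
    fix A :: "'i \<Rightarrow> real set"
    assume A: "\<And>i. i \<in> I \<Longrightarrow> A i \<in> sets lborel"
    then have box: "Pi\<^sub>E I A \<in> sets L"
      unfolding L_def by (intro sets_PiM_I_finite I) auto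
    let ?A = "\<lambda>i. {x. c i + r * x \<in> A i}"
    have A': "?A i \<in> sets lborel" if "i \<in> I" for i
    proof -
      have [measurable]: "A i \<in> sets borel" using A[OF that] by simp
      show ?thesis by simp
    qed
    have em: "emeasure lborel (A i) = ennreal r * emeasure lborel (?A i)" if "i \<in> I" for i
    proof -
      have [measurable]: "A i \<in> sets borel" using A[OF that] by simp
      have "emeasure lborel (A i) = (\<integral>\<^sup>+x. indicator (A i) x \<partial>lborel)"
        by simp
      also have "\<dots> = ennreal \<bar>r\<bar> * (\<integral>\<^sup>+x. indicator (A i) (c i + r * x) \<partial>lborel)"
        using r by (intro nn_integral_real_affine) auto
      also have "(\<integral>\<^sup>+x. indicator (A i) (c i + r * x) \<partial>lborel) = (\<integral>\<^sup>+x. indicator (?A i) x \<partial>lborel)"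
        by (intro nn_integral_cong) (simp split: split_indicator)
      also have "\<dots> = emeasure lborel (?A i)"
        using A'[OF that] by simp
      finally show ?thesis using r by simp
    qed
    have pre: "T -` Pi\<^sub>E I A \<inter> space L = Pi\<^sub>E I ?A"
      by (auto simp: T_def L_def space_PiM PiE_def Pi_def)
    have "emeasure (density (distr L L T) (\<lambda>_. ennreal (r ^ card I))) (Pi\<^sub>E I A)
        = ennreal (r ^ card I) * emeasure L (T -` Pi\<^sub>E I A \<inter> space L)"
      using box by (simp add: emeasure_density nn_integral_cmult emeasure_distr)
    also have "\<dots> = (\<Prod>i\<in>I. ennreal r) * (\<Prod>i\<in>I. emeasure lborel (?A i))"
    proof -
      have "emeasure L (Pi\<^sub>E I ?A) = (\<Prod>i\<in>I. emeasure lborel (?A i))"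
        unfolding L_def using A' by (intro lborel_family.emeasure_PiM[OF I]) auto
      then show ?thesis
        unfolding pre using r by (simp add: ennreal_power)
    qed
    also have "\<dots> = (\<Prod>i\<in>I. emeasure lborel (A i))"
      using em by (simp add: prod.distrib)
    finally show "emeasure (density (distr L L T) (\<lambda>_. ennreal (r ^ card I))) (Pi\<^sub>E I A)
        = (\<Prod>i\<in>I. emeasure lborel (A i))" .
  qed
  then have "(\<integral>\<^sup>+x. g x \<partial>Pi\<^sub>M I (\<lambda>_. lborel)) =
      (\<integral>\<^sup>+x. g x \<partial>density (distr L L T) (\<lambda>_. ennreal (r ^ card I)))"
    by simp
  also have "\<dots> = ennreal (r ^ card I) * (\<integral>\<^sup>+u. g (T u) \<partial>L)"
    using g by (simp add: nn_integral_density nn_integral_cmult nn_integral_distr L_def[symmetric])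
  finally show ?thesis
    by (simp add: T_def L_def)
qed

section \<open>Moving the center along one coordinate\<close>

text \<open>In absolute coordinates the interval keeps its length and its center moves away from the
  origin. What the two intervals share cancels, so only the two differences have to be compared;
  since \<open>F\<close> is even, \<open>0 \<le> p \<le> q\<close> may be assumed.\<close>

lemma nn_integral_interval_mono_center:
  fixes k :: "real \<Rightarrow> ennreal"
  assumes k: "mono k" and [measurable]: "k \<in> borel_measurable borel" and r: "0 < r"
    and pq: "\<bar>p\<bar> \<le> \<bar>q\<bar>"
  shows "(\<integral>\<^sup>+s. k \<bar>p + r * s\<bar> * indicator {-a..a} s \<partial>lborel)
       \<le> (\<integral>\<^sup>+s. k \<bar>q + r * s\<bar> * indicator {-a..a} s \<partial>lborel)"
proof -
  define F where "F p = (\<integral>\<^sup>+s. k \<bar>s\<bar> * indicator {p-r*a..p+r*a} s \<partial>lborel)" for p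
  have F: "F p = ennreal r * (\<integral>\<^sup>+s. k \<bar>p + r * s\<bar> * indicator {-a..a} s \<partial>lborel)" for p
  proof -
    have "F p = ennreal \<bar>r\<bar> * (\<integral>\<^sup>+s. k \<bar>p + r * s\<bar> * indicator {p-r*a..p+r*a} (p + r * s) \<partial>lborel)"
      unfolding F_def using r by (intro nn_integral_real_affine) auto
    also have "(\<integral>\<^sup>+s. k \<bar>p + r * s\<bar> * indicator {p-r*a..p+r*a} (p + r * s) \<partial>lborel)
        = (\<integral>\<^sup>+s. k \<bar>p + r * s\<bar> * indicator {-a..a} s \<partial>lborel)"
    proof (intro nn_integral_cong arg_cong2[where f="(*)"] refl)
      fix s :: real
      have "- (r * a) \<le> r * s \<longleftrightarrow> - a \<le> s" "r * s \<le> r * a \<longleftrightarrow> s \<le> a"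
        using r mult_le_cancel_left_pos[of r "-a" s] by simp_all
      then show "indicator {p-r*a..p+r*a} (p + r * s) = (indicator {-a..a} s :: ennreal)"
        by (simp split: split_indicator)
    qed
    finally show ?thesis using r by simp
  qed
  have even: "F (-p) = F p" for p
  proof -
    have "F (-p) = ennreal \<bar>-1\<bar> * (\<integral>\<^sup>+s. k \<bar>0 + -1 * s\<bar> * indicator {-p-r*a..-p+r*a} (0 + -1 * s) \<partial>lborel)"
      unfolding F_def by (intro nn_integral_real_affine) auto
    also have "\<dots> = F p"
      unfolding F_def by (simp, intro nn_integral_cong arg_cong2[where f="(*)"])
        (auto split: split_indicator)
    finally show ?thesis .
  qed
  have main: "F p \<le> F q" if "0 \<le> p" "p \<le> q" for p q
  proof -
    let ?P = "{p-r*a..p+r*a}" and ?Q = "{q-r*a..q+r*a}"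
    have split: "(\<integral>\<^sup>+s. k \<bar>s\<bar> * indicator A s \<partial>lborel) =
      (\<integral>\<^sup>+s. k \<bar>s\<bar> * indicator (A \<inter> B) s \<partial>lborel) + (\<integral>\<^sup>+s. k \<bar>s\<bar> * indicator (A - B) s \<partial>lborel)"
      if "A \<in> sets borel" "B \<in> sets borel" for A B
    proof -
      have [measurable]: "A \<in> sets borel" "B \<in> sets borel" using that by auto
      show ?thesis
        by (subst nn_integral_add[symmetric]) (auto intro!: nn_integral_cong split: split_indicator)
    qed
    \<comment> \<open>Reflection at the midpoint of \<open>p\<close> and \<open>q\<close> exchanges
      the two differences, and it does not decrease \<open>\<bar>s\<bar>\<close> on
      \<open>?P - ?Q\<close> because that set lies to the left of the midpoint, which is
      nonnegative.\<close>
    have "(\<integral>\<^sup>+s. k \<bar>s\<bar> * indicator (?P - ?Q) s \<partial>lborel)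
        \<le> (\<integral>\<^sup>+s. k \<bar>p + q + -1 * s\<bar> * indicator (?Q - ?P) (p + q + -1 * s) \<partial>lborel)"
    proof (intro nn_integral_mono)
      fix s
      show "k \<bar>s\<bar> * indicator (?P - ?Q) s
        \<le> k \<bar>p + q + -1 * s\<bar> * indicator (?Q - ?P) (p + q + -1 * s)"
      proof (cases "s \<in> ?P - ?Q")
        case True
        then have "p + q + -1 * s \<in> ?Q - ?P" "\<bar>s\<bar> \<le> \<bar>p + q + -1 * s\<bar>"
          using that by auto
        then show ?thesis using True monoD[OF k] by simp
      qed simp
    qed
    also have "\<dots> = (\<integral>\<^sup>+s. k \<bar>s\<bar> * indicator (?Q - ?P) s \<partial>lborel)"
      using nn_integral_real_affine[of "\<lambda>s. k \<bar>s\<bar> * indicator (?Q - ?P) s" "-1" "p + q"] by simp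
    finally show ?thesis
      unfolding F_def by (subst split[of ?P ?Q], simp, simp, subst split[of ?Q ?P], simp, simp)
        (auto simp: Int_commute intro: add_left_mono)
  qed
  have "F p \<le> F q"
    using main[of "\<bar>p\<bar>" "\<bar>q\<bar>"] pq even[of p] even[of q] by (auto simp: abs_if split: if_splits)
  then show ?thesis
    unfolding F using r by (simp add: ennreal_mult_le_mult_iff)
qed

lemma component_measurable_lebesgue_Rd:
  "i < d \<Longrightarrow> (\<lambda>u. u i) \<in> borel_measurable (lebesgue_Rd d)"
  unfolding lebesgue_Rd_def using measurable_component_singleton[of i "{..<d}" "\<lambda>_. lborel :: real measure"]
  by simp

lemma l1_norm_affine_measurable [measurable]:
  "(\<lambda>u. l1_norm d (\<lambda>i. c i + r * u i)) \<in> borel_measurable (lebesgue_Rd d)"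
  unfolding l1_norm_def
  by (intro borel_measurable_sum borel_measurable_abs borel_measurable_add borel_measurable_times
      borel_measurable_const component_measurable_lebesgue_Rd) auto

lemma l1_norm_measurable [measurable]: "l1_norm d \<in> borel_measurable (lebesgue_Rd d)"
  using l1_norm_affine_measurable[of d "\<lambda>_. 0" 1] by simp

lemma space_lebesgue_Rd: "space (lebesgue_Rd d) = Rd d"
  by (simp add: lebesgue_Rd_def Rd_def space_PiM)

lemma l1_norm_nonneg [simp]: "0 \<le> l1_norm d x"
  by (simp add: l1_norm_def sum_nonneg)

lemma l1_norm_triangle: "l1_norm d (\<lambda>i. x i + y i) \<le> l1_norm d x + l1_norm d y"
  unfolding l1_norm_def sum.distrib[symmetric] by (intro sum_mono abs_triangle_ineq)

lemma l1_norm_scale: "l1_norm d (\<lambda>i. a * x i) = \<bar>a\<bar> * l1_norm d x"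
  by (simp add: l1_norm_def abs_mult sum_distrib_left)

lemma l1_norm_minus_commute: "l1_norm d (\<lambda>i. x i - y i) = l1_norm d (\<lambda>i. y i - x i)"
  by (simp add: l1_norm_def abs_minus_commute)

lemma l1_norm_remove:
  "i < d \<Longrightarrow> l1_norm d x = \<bar>x i\<bar> + (\<Sum>j\<in>{..<d} - {i}. \<bar>x j\<bar>)"
  using sum.remove[of "{..<d}" i "\<lambda>i. \<bar>x i\<bar>"] by (simp add: l1_norm_def)

text \<open>Up to the factor \<open>2 ^ d / fact d\<close>, the volume of the unit ball, this is the
  average of \<open>\<phi>\<close> of the norm over the ball with center \<open>c\<close> and radius
  \<open>r\<close>. In relative coordinates \<open>u\<close> the domain is fixed, and
  \<open>c\<close> and \<open>r\<close> enter only the integrand.\<close>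

definition ball_int :: "nat \<Rightarrow> (real \<Rightarrow> ennreal) \<Rightarrow> (nat \<Rightarrow> real) \<Rightarrow> real \<Rightarrow> ennreal" where
  "ball_int d \<phi> c r =
    (\<integral>\<^sup>+u. \<phi> (l1_norm d (\<lambda>i. c i + r * u i)) * indicator {..1} (l1_norm d u) \<partial>lebesgue_Rd d)"

lemma ball_int_cong: "(\<And>i. i < d \<Longrightarrow> c i = c' i) \<Longrightarrow> ball_int d \<phi> c r = ball_int d \<phi> c' r"
  unfolding ball_int_def l1_norm_def by (intro nn_integral_cong) simp

text \<open>With all other coordinates fixed, \<open>u i\<close> ranges over an interval symmetric
  about 0 (empty if the others already exceed norm 1), and the other coordinates merely shift the
  argument of \<open>\<phi>\<close>. So the one-dimensional comparison applies on every
  slice.\<close>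

lemma ball_int_mono_coordinate:
  assumes \<phi>: "mono \<phi>" and [measurable]: "\<phi> \<in> borel_measurable borel" and r: "0 < r"
    and i: "i < d" and v: "\<bar>c i\<bar> \<le> \<bar>v\<bar>"
  shows "ball_int d \<phi> c r \<le> ball_int d \<phi> (c(i := v)) r"
proof -
  let ?I = "{..<d} - {i}" and ?M = "\<lambda>_::nat. lborel :: real measure"
  have ins: "{..<d} = insert i ?I" using i by auto
  define F where "F p x = (\<integral>\<^sup>+s. \<phi> (\<bar>p + r * s\<bar> + (\<Sum>j\<in>?I. \<bar>c j + r * x j\<bar>)) *
      indicator {-(1 - (\<Sum>j\<in>?I. \<bar>x j\<bar>))..1 - (\<Sum>j\<in>?I. \<bar>x j\<bar>)} s \<partial>lborel)" for p and x :: "nat \<Rightarrow> real"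
  have eq: "ball_int d \<phi> (c(i := p)) r = (\<integral>\<^sup>+x. F p x \<partial>Pi\<^sub>M ?I ?M)" for p
  proof -
    have meas: "(\<lambda>u. \<phi> (l1_norm d (\<lambda>j. (c(i := p)) j + r * u j)) * indicator {..1} (l1_norm d u))
        \<in> borel_measurable (lebesgue_Rd d)"
      by measurable
    have "ball_int d \<phi> (c(i := p)) r = (\<integral>\<^sup>+x. \<integral>\<^sup>+s.
        \<phi> (l1_norm d (\<lambda>j. (c(i := p)) j + r * (x(i := s)) j)) * indicator {..1} (l1_norm d (x(i := s)))
        \<partial>lborel \<partial>Pi\<^sub>M ?I ?M)"
      unfolding ball_int_def lebesgue_Rd_def
      by (rule lborel_family.product_nn_integral_insert[of ?I i, folded ins])
        (use meas in \<open>simp_all add: lebesgue_Rd_def\<close>)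
    also have "\<dots> = (\<integral>\<^sup>+x. F p x \<partial>Pi\<^sub>M ?I ?M)"
      unfolding F_def
    proof (intro nn_integral_cong arg_cong2[where f="(*)"])
      fix x s
      have "(\<Sum>j\<in>?I. \<bar>(c(i := p)) j + r * (x(i := s)) j\<bar>) = (\<Sum>j\<in>?I. \<bar>c j + r * x j\<bar>)"
        "(\<Sum>j\<in>?I. \<bar>(x(i := s)) j\<bar>) = (\<Sum>j\<in>?I. \<bar>x j\<bar>)"
        by (auto intro!: sum.cong)
      then show "\<phi> (l1_norm d (\<lambda>j. (c(i := p)) j + r * (x(i := s)) j))
          = \<phi> (\<bar>p + r * s\<bar> + (\<Sum>j\<in>?I. \<bar>c j + r * x j\<bar>))"
        "indicator {..1} (l1_norm d (x(i := s)))
          = (indicator {-(1 - (\<Sum>j\<in>?I. \<bar>x j\<bar>))..1 - (\<Sum>j\<in>?I. \<bar>x j\<bar>)} s :: ennreal)"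
        by (auto simp: l1_norm_remove[OF i] split: split_indicator)
    qed
    finally show ?thesis .
  qed
  have "F (c i) x \<le> F v x" for x
    unfolding F_def
    using v r
    by (intro nn_integral_interval_mono_center[where k="\<lambda>s. \<phi> (s + (\<Sum>j\<in>?I. \<bar>c j + r * x j\<bar>))"])
      (auto intro!: monoI monoD[OF \<phi>])
  then have "ball_int d \<phi> (c(i := c i)) r \<le> ball_int d \<phi> (c(i := v)) r"
    unfolding eq by (intro nn_integral_mono) auto
  then show ?thesis by simp
qed

lemma ball_int_mono_abs:
  assumes \<phi>: "mono \<phi>" "\<phi> \<in> borel_measurable borel" and r: "0 < r"
    and c: "\<And>i. i < d \<Longrightarrow> \<bar>c i\<bar> \<le> \<bar>c' i\<bar>"
  shows "ball_int d \<phi> c r \<le> ball_int d \<phi> c' r"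
proof -
  have "ball_int d \<phi> c r \<le> ball_int d \<phi> (\<lambda>i. if i < n then c' i else c i) r" if "n \<le> d" for n
    using that
  proof (induction n)
    case (Suc n)
    let ?e = "\<lambda>i. if i < n then c' i else c i"
    have "ball_int d \<phi> ?e r \<le> ball_int d \<phi> (?e(n := c' n)) r"
      using Suc.prems c[of n] by (intro ball_int_mono_coordinate \<phi> r) auto
    also have "?e(n := c' n) = (\<lambda>i. if i < Suc n then c' i else c i)"
      by auto
    finally show ?case using Suc by auto
  qed simp
  from this[of d] show ?thesis
    using ball_int_cong[of d "\<lambda>i. if i < d then c' i else c i" c'] by simp
qed

section \<open>Merging two coordinates of the center\<close>

text \<open>The substitution \<open>p = x + y\<close>, \<open>q = x - y\<close> is carried out as
  two one-dimensional affine substitutions with Fubini in between; the second one contributes the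
  Jacobian \<open>1/2\<close>.\<close>

lemma nn_integral_rotate_plane:
  assumes [measurable]: "(\<lambda>(x, y). f x y) \<in> borel_measurable (lborel \<Otimes>\<^sub>M lborel)"
  shows "(\<integral>\<^sup>+x. \<integral>\<^sup>+y. f x y \<partial>lborel \<partial>lborel) =
    ennreal (1/2) * (\<integral>\<^sup>+p. \<integral>\<^sup>+q. f ((p + q) / 2) ((p - q) / 2) \<partial>lborel \<partial>(lborel :: real measure))"
proof -
  have [measurable]: "(\<lambda>z. f (g z) (h z)) \<in> borel_measurable M"
    if "g \<in> borel_measurable M" "h \<in> borel_measurable M" for M :: "'z measure" and g h
    using measurable_compose[OF measurable_Pair[of g M lborel h lborel] assms] that by simp
  have "(\<integral>\<^sup>+x. \<integral>\<^sup>+y. f x y \<partial>lborel \<partial>lborel) = (\<integral>\<^sup>+y. \<integral>\<^sup>+x. f x y \<partial>lborel \<partial>lborel)"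
    by (rule lborel_pair.Fubini') (use assms in simp)
  also have "\<dots> = (\<integral>\<^sup>+y. \<integral>\<^sup>+p. f (p - y) y \<partial>lborel \<partial>lborel)"
  proof (rule nn_integral_cong)
    fix y :: real
    show "(\<integral>\<^sup>+x. f x y \<partial>lborel) = (\<integral>\<^sup>+p. f (p - y) y \<partial>lborel)"
      using nn_integral_real_affine[of "\<lambda>x. f x y" 1 "-y"] by (simp add: add.commute)
  qed
  also have "\<dots> = (\<integral>\<^sup>+p. \<integral>\<^sup>+y. f (p - y) y \<partial>lborel \<partial>lborel)"
    by (rule lborel_pair.Fubini') simp
  also have "\<dots> = (\<integral>\<^sup>+p. ennreal (1/2) * (\<integral>\<^sup>+q. f ((p + q) / 2) ((p - q) / 2) \<partial>lborel) \<partial>lborel)"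
  proof (intro nn_integral_cong)
    fix p :: real
    show "(\<integral>\<^sup>+y. f (p - y) y \<partial>lborel) = ennreal (1/2) * (\<integral>\<^sup>+q. f ((p + q) / 2) ((p - q) / 2) \<partial>lborel)"
      using nn_integral_real_affine[of "\<lambda>y. f (p - y) y" "-1/2" "p/2"]
      by (simp add: add_divide_distrib diff_divide_distrib)
  qed
  also have "\<dots> = ennreal (1/2) * (\<integral>\<^sup>+p. \<integral>\<^sup>+q. f ((p + q) / 2) ((p - q) / 2) \<partial>lborel \<partial>lborel)"
    by (intro nn_integral_cmult) measurable
  finally show ?thesis .
qed

lemma nn_integral_square_mono:
  fixes k :: "real \<Rightarrow> ennreal"
  assumes k: "mono k" and [measurable]: "k \<in> borel_measurable borel" and r: "0 < r"
    and xy: "0 \<le> x" "0 \<le> y"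
  shows "(\<integral>\<^sup>+s. \<integral>\<^sup>+t. k (\<bar>x + r * s\<bar> + \<bar>y + r * t\<bar>) * indicator {..a} (\<bar>s\<bar> + \<bar>t\<bar>) \<partial>lborel \<partial>lborel)
    \<le> (\<integral>\<^sup>+s. \<integral>\<^sup>+t. k (\<bar>x + y + r * s\<bar> + \<bar>r * t\<bar>) * indicator {..a} (\<bar>s\<bar> + \<bar>t\<bar>) \<partial>lborel \<partial>lborel)"
proof -
  have abs_max: "\<bar>u\<bar> + \<bar>v\<bar> = max \<bar>u + v\<bar> \<bar>u - v\<bar>" for u v :: real
    by (auto simp: abs_if max_def)
  define G where "G p x = (\<integral>\<^sup>+q. k (max p \<bar>x + r * q\<bar>) * indicator {-a..a} q \<partial>lborel)" for p x
  have rot: "(\<integral>\<^sup>+s. \<integral>\<^sup>+t. k (\<bar>x + r * s\<bar> + \<bar>y + r * t\<bar>) * indicator {..a} (\<bar>s\<bar> + \<bar>t\<bar>) \<partial>lborel \<partial>lborel)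
    = ennreal (1/2) * (\<integral>\<^sup>+p. G \<bar>x + y + r * p\<bar> (x - y) * indicator {-a..a} p \<partial>lborel)" for x y
  proof -
    have "(\<integral>\<^sup>+s. \<integral>\<^sup>+t. k (\<bar>x + r * s\<bar> + \<bar>y + r * t\<bar>) * indicator {..a} (\<bar>s\<bar> + \<bar>t\<bar>) \<partial>lborel \<partial>lborel)
      = ennreal (1/2) * (\<integral>\<^sup>+p. \<integral>\<^sup>+q. k (\<bar>x + r * ((p + q) / 2)\<bar> + \<bar>y + r * ((p - q) / 2)\<bar>) *
          indicator {..a} (\<bar>(p + q) / 2\<bar> + \<bar>(p - q) / 2\<bar>) \<partial>lborel \<partial>lborel)"
      by (intro nn_integral_rotate_plane) simp
    also have "(\<integral>\<^sup>+p. \<integral>\<^sup>+q. k (\<bar>x + r * ((p + q) / 2)\<bar> + \<bar>y + r * ((p - q) / 2)\<bar>) *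
          indicator {..a} (\<bar>(p + q) / 2\<bar> + \<bar>(p - q) / 2\<bar>) \<partial>lborel \<partial>lborel)
      = (\<integral>\<^sup>+p. \<integral>\<^sup>+q. k (max \<bar>x + y + r * p\<bar> \<bar>x - y + r * q\<bar>) * indicator {-a..a} q * indicator {-a..a} p \<partial>lborel \<partial>lborel)"
    proof (intro nn_integral_cong)
      fix p q :: real
      have "x + r * ((p + q) / 2) + (y + r * ((p - q) / 2)) = x + y + r * p"
        "x + r * ((p + q) / 2) - (y + r * ((p - q) / 2)) = x - y + r * q"
        "(p + q) / 2 + (p - q) / 2 = p" "(p + q) / 2 - (p - q) / 2 = q"
        by (simp_all add: field_simps)
      then have "\<bar>x + r * ((p + q) / 2)\<bar> + \<bar>y + r * ((p - q) / 2)\<bar> = max \<bar>x + y + r * p\<bar> \<bar>x - y + r * q\<bar>"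
        and e: "\<bar>(p + q) / 2\<bar> + \<bar>(p - q) / 2\<bar> = max \<bar>p\<bar> \<bar>q\<bar>"
        unfolding abs_max[of "x + r * ((p + q) / 2)"] abs_max[of "(p + q) / 2"] by (simp_all only:)
      moreover have "indicator {..a} (max \<bar>p\<bar> \<bar>q\<bar>) = (indicator {-a..a} q * indicator {-a..a} p :: ennreal)"
        by (auto simp: indicator_def)
      ultimately show "k (\<bar>x + r * ((p + q) / 2)\<bar> + \<bar>y + r * ((p - q) / 2)\<bar>) *
          indicator {..a} (\<bar>(p + q) / 2\<bar> + \<bar>(p - q) / 2\<bar>)
        = k (max \<bar>x + y + r * p\<bar> \<bar>x - y + r * q\<bar>) * indicator {-a..a} q * indicator {-a..a} p"
        by (simp only: mult.assoc)
    qed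
    also have "\<dots> = (\<integral>\<^sup>+p. G \<bar>x + y + r * p\<bar> (x - y) * indicator {-a..a} p \<partial>lborel)"
      unfolding G_def by (intro nn_integral_cong nn_integral_multc) measurable
    finally show ?thesis .
  qed
  \<comment> \<open>Replacing \<open>(x, y)\<close> by \<open>(x + y, 0)\<close> leaves the sum of
    the two coordinates unchanged, so the interval for \<open>p\<close> stays. The center for
    \<open>q\<close> changes from \<open>x - y\<close> to \<open>x + y\<close>, which is at least as
    far from 0 because both coordinates are nonnegative.\<close>
  have "G p (x - y) \<le> G p (x + y)" for p
    unfolding G_def using xy r
    by (intro nn_integral_interval_mono_center[where k="\<lambda>s. k (max p s)"])
      (auto intro!: monoI monoD[OF k])
  then have "(\<integral>\<^sup>+p. G \<bar>x + y + r * p\<bar> (x - y) * indicator {-a..a} p \<partial>lborel)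
      \<le> (\<integral>\<^sup>+p. G \<bar>x + y + r * p\<bar> (x + y) * indicator {-a..a} p \<partial>lborel)"
    by (intro nn_integral_mono mult_right_mono) auto
  then show ?thesis
    using rot[of x y] rot[of "x + y" 0] by (simp add: mult_left_mono)
qed

text \<open>The slice of the unit ball along the coordinates \<open>i\<close> and \<open>j\<close>
  is a planar l1 ball whose radius is 1 minus the norm of the other coordinates, and these again
  only shift the argument of \<open>\<phi>\<close>. Hence the planar comparison can be integrated
  over the slices.\<close>

lemma ball_int_merge_coordinates:
  assumes \<phi>: "mono \<phi>" and [measurable]: "\<phi> \<in> borel_measurable borel" and r: "0 < r"
    and ij: "i < d" "j < d" "i \<noteq> j" and c: "0 \<le> c i" "0 \<le> c j"
  shows "ball_int d \<phi> c r \<le> ball_int d \<phi> (c(i := c i + c j, j := 0)) r"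
proof -
  let ?I = "{..<d} - {i, j}" and ?M = "\<lambda>_::nat. lborel :: real measure"
  have ins: "{..<d} = insert i (insert j ?I)" using ij by auto
  define F where "F p q x = (\<integral>\<^sup>+s. \<integral>\<^sup>+t. \<phi> (\<bar>p + r * s\<bar> + \<bar>q + r * t\<bar> + (\<Sum>l\<in>?I. \<bar>c l + r * x l\<bar>)) *
      indicator {..1 - (\<Sum>l\<in>?I. \<bar>x l\<bar>)} (\<bar>s\<bar> + \<bar>t\<bar>) \<partial>lborel \<partial>lborel)" for p q and x :: "nat \<Rightarrow> real"
  have norm: "l1_norm d y = \<bar>y i\<bar> + \<bar>y j\<bar> + (\<Sum>l\<in>?I. \<bar>y l\<bar>)" for y
  proof -
    have "?I = {..<d} - {i} - {j}" by auto
    then show ?thesis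
      unfolding l1_norm_remove[OF ij(1)]
      using ij sum.remove[of "{..<d} - {i}" j "\<lambda>l. \<bar>y l\<bar>"] by simp
  qed
  have eq: "ball_int d \<phi> (c(i := p, j := q)) r = (\<integral>\<^sup>+x. F p q x \<partial>Pi\<^sub>M ?I ?M)" for p q
  proof -
    define G where "G = (\<lambda>u. \<phi> (l1_norm d (\<lambda>l. (c(i := p, j := q)) l + r * u l)) * indicator {..1} (l1_norm d u))"
    have meas: "G \<in> borel_measurable (Pi\<^sub>M {..<d} ?M)"
      unfolding G_def lebesgue_Rd_def[symmetric] by measurable
    have meas2: "(\<lambda>(s, t). G (x(j := t, i := s))) \<in> borel_measurable (lborel \<Otimes>\<^sub>M lborel)"
      if "x \<in> space (Pi\<^sub>M ?I ?M)" for x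
    proof -
      have "(\<lambda>z. x(j := snd z, i := fst z)) \<in> lborel \<Otimes>\<^sub>M lborel \<rightarrow>\<^sub>M Pi\<^sub>M {..<d} ?M"
      proof (rule measurable_PiM_single')
        show "(\<lambda>z. (x(j := snd z, i := fst z)) l) \<in> lborel \<Otimes>\<^sub>M lborel \<rightarrow>\<^sub>M lborel" for l
          by (cases "l = i"; cases "l = j") simp_all
      qed (use that ij in \<open>auto simp: space_PiM PiE_def extensional_def\<close>)
      from measurable_compose[OF this meas] show ?thesis
        by (simp add: case_prod_unfold)
    qed
    have "ball_int d \<phi> (c(i := p, j := q)) r = (\<integral>\<^sup>+y. \<integral>\<^sup>+s. G (y(i := s)) \<partial>lborel \<partial>Pi\<^sub>M (insert j ?I) ?M)"
      unfolding ball_int_def lebesgue_Rd_def G_def[symmetric]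
      using lborel_family.product_nn_integral_insert[of "insert j ?I" i G] meas ins ij
      by (simp flip: G_def)
    also have "\<dots> = (\<integral>\<^sup>+x. \<integral>\<^sup>+t. \<integral>\<^sup>+s. G (x(j := t, i := s)) \<partial>lborel \<partial>lborel \<partial>Pi\<^sub>M ?I ?M)"
    proof (rule lborel_family.product_nn_integral_insert)
      have "(\<lambda>(y, s). y(i := s)) \<in> Pi\<^sub>M (insert j ?I) ?M \<Otimes>\<^sub>M lborel \<rightarrow>\<^sub>M Pi\<^sub>M {..<d} ?M"
        using measurable_add_dim[of i "insert j ?I" ?M] ins by simp
      from measurable_compose[OF this meas]
      show "(\<lambda>y. \<integral>\<^sup>+s. G (y(i := s)) \<partial>lborel) \<in> borel_measurable (Pi\<^sub>M (insert j ?I) ?M)"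
        by (intro lborel.borel_measurable_nn_integral) (simp add: case_prod_unfold)
    qed auto
    also have "\<dots> = (\<integral>\<^sup>+x. \<integral>\<^sup>+s. \<integral>\<^sup>+t. G (x(j := t, i := s)) \<partial>lborel \<partial>lborel \<partial>Pi\<^sub>M ?I ?M)"
      using meas2 by (intro nn_integral_cong lborel_pair.Fubini') simp
    also have "\<dots> = (\<integral>\<^sup>+x. F p q x \<partial>Pi\<^sub>M ?I ?M)"
      unfolding F_def G_def
    proof (intro nn_integral_cong arg_cong2[where f="(*)"])
      fix x s t
      have *: "(\<Sum>l\<in>?I. \<bar>(c(i := p, j := q)) l + r * (x(j := t, i := s)) l\<bar>) = (\<Sum>l\<in>?I. \<bar>c l + r * x l\<bar>)"
        "(\<Sum>l\<in>?I. \<bar>(x(j := t, i := s)) l\<bar>) = (\<Sum>l\<in>?I. \<bar>x l\<bar>)"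
        by (auto intro!: sum.cong)
      show "\<phi> (l1_norm d (\<lambda>l. (c(i := p, j := q)) l + r * (x(j := t, i := s)) l))
          = \<phi> (\<bar>p + r * s\<bar> + \<bar>q + r * t\<bar> + (\<Sum>l\<in>?I. \<bar>c l + r * x l\<bar>))"
        unfolding norm * using ij by simp
      show "indicator {..1} (l1_norm d (x(j := t, i := s)))
          = (indicator {..1 - (\<Sum>l\<in>?I. \<bar>x l\<bar>)} (\<bar>s\<bar> + \<bar>t\<bar>) :: ennreal)"
        unfolding norm * using ij by (auto split: split_indicator)
    qed
    finally show ?thesis .
  qed
  have "F (c i) (c j) x \<le> F (c i + c j) 0 x" for x
    unfolding F_def add_0_left
    using c r
    by (intro nn_integral_square_mono[where k="\<lambda>s. \<phi> (s + (\<Sum>l\<in>?I. \<bar>c l + r * x l\<bar>))"])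
      (auto intro!: monoI monoD[OF \<phi>])
  then have "ball_int d \<phi> (c(i := c i, j := c j)) r \<le> ball_int d \<phi> (c(i := c i + c j, j := 0)) r"
    unfolding eq by (intro nn_integral_mono) auto
  then show ?thesis by simp
qed

lemma ball_int_le_axis:
  assumes \<phi>: "mono \<phi>" "\<phi> \<in> borel_measurable borel" and r: "0 < r" and d: "0 < d"
  shows "ball_int d \<phi> c r \<le> ball_int d \<phi> (\<lambda>i. if i = 0 then l1_norm d c else 0) r"
proof -
  \<comment> \<open>In \<open>?e n\<close> coordinate 0 has absorbed the absolute values of the
    first \<open>n\<close> coordinates. The induction starts at \<open>?e 1\<close>, the vector of
    absolute values, since \<open>?e 0\<close> would have lost \<open>c 0\<close>.\<close>
  let ?e = "\<lambda>n i. if i = 0 then (\<Sum>j<n. \<bar>c j\<bar>) else if i < n then 0 else \<bar>c i\<bar>"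
  have "ball_int d \<phi> c r \<le> ball_int d \<phi> (?e (Suc n)) r" if "Suc n \<le> d" for n
    using that
  proof (induction n)
    case 0
    show ?case
      by (intro ball_int_mono_abs \<phi> r) auto
  next
    case (Suc n)
    then have "ball_int d \<phi> c r \<le> ball_int d \<phi> (?e (Suc n)) r"
      by simp
    also have "\<dots> \<le> ball_int d \<phi> ((?e (Suc n))(0 := ?e (Suc n) 0 + ?e (Suc n) (Suc n), Suc n := 0)) r"
      using Suc.prems by (intro ball_int_merge_coordinates \<phi> r) (auto simp: sum_nonneg)
    also have "(?e (Suc n))(0 := ?e (Suc n) 0 + ?e (Suc n) (Suc n), Suc n := 0) = ?e (Suc (Suc n))"
      by (auto simp: fun_eq_iff)
    finally show ?case .
  qed
  moreover have "Suc (d - 1) = d" using d by simp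
  ultimately have "ball_int d \<phi> c r \<le> ball_int d \<phi> (?e d) r"
    by (metis order_refl)
  also have "\<dots> = ball_int d \<phi> (\<lambda>i. if i = 0 then l1_norm d c else 0) r"
    by (intro ball_int_cong) (auto simp: l1_norm_def)
  finally show ?thesis .
qed

section \<open>Polar coordinates\<close>

lemma nn_integral_abs:
  fixes g :: "real \<Rightarrow> ennreal"
  assumes [measurable]: "g \<in> borel_measurable borel"
  shows "(\<integral>\<^sup>+x. g \<bar>x\<bar> \<partial>lborel) = 2 * (\<integral>\<^sup>+x. g x * indicator {0..} x \<partial>lborel)"
proof -
  have "(\<integral>\<^sup>+x. g \<bar>x\<bar> \<partial>lborel) =
      (\<integral>\<^sup>+x. g x * indicator {0..} x + g (-x) * indicator {..<0} x \<partial>lborel)"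
    by (intro nn_integral_cong) (auto split: split_indicator)
  also have "\<dots> = (\<integral>\<^sup>+x. g x * indicator {0..} x \<partial>lborel) + (\<integral>\<^sup>+x. g (-x) * indicator {..<0} x \<partial>lborel)"
    by (intro nn_integral_add) auto
  also have "(\<integral>\<^sup>+x. g (-x) * indicator {..<0} x \<partial>lborel) = (\<integral>\<^sup>+x. g x * indicator {0<..} x \<partial>lborel)"
    by (subst nn_integral_real_affine[where c="-1" and t=0])
      (auto intro!: nn_integral_cong split: split_indicator)
  also have "\<dots> = (\<integral>\<^sup>+x. g x * indicator {0..} x \<partial>lborel)"
    using AE_lborel_singleton[of 0]
    by (intro nn_integral_cong_AE) (auto split: split_indicator)
  finally show ?thesis by (simp add: mult_2)
qed

lemma nn_integral_power_Icc:
  assumes "0 \<le> (s::real)"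
  shows "(\<integral>\<^sup>+\<rho>. ennreal (\<rho> ^ n) * indicator {0..s} \<rho> \<partial>lborel) = ennreal (s ^ Suc n / real (Suc n))"
proof -
  have "(\<integral>\<^sup>+\<rho>. ennreal (\<rho> ^ n) * indicator {0..s} \<rho> \<partial>lborel) = ennreal (s ^ Suc n / real (Suc n) - 0 ^ Suc n / real (Suc n))"
    using assms
    by (intro nn_integral_FTC_Icc[where F="\<lambda>x. x ^ Suc n / real (Suc n)"])
      (auto intro!: derivative_eq_intros simp del: power_Suc of_nat_Suc)
  then show ?thesis by simp
qed

text \<open>The constant times \<open>\<rho> ^ (card I - 1)\<close> is the derivative in
  \<open>\<rho>\<close> of the volume \<open>2 ^ n / fact n * \<rho> ^ n\<close> of the ball of
  radius \<open>\<rho>\<close> in \<open>n = card I\<close> dimensions. Adding a coordinate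
  \<open>y\<close> applies the induction hypothesis to \<open>h\<close> shifted by
  \<open>\<bar>y\<bar>\<close>, which is why \<open>h\<close> is arbitrary in the induction.\<close>

lemma nn_integral_l1_polar:
  fixes h :: "real \<Rightarrow> ennreal"
  assumes "finite I" "I \<noteq> {}" "h \<in> borel_measurable borel"
  shows "(\<integral>\<^sup>+x. h (\<Sum>i\<in>I. \<bar>x i\<bar>) \<partial>Pi\<^sub>M I (\<lambda>_. lborel)) =
    ennreal (2 ^ card I / fact (card I - 1)) *
      (\<integral>\<^sup>+\<rho>. h \<rho> * (ennreal (\<rho> ^ (card I - 1)) * indicator {0..} \<rho>) \<partial>lborel)"
  using assms
proof (induction I arbitrary: h rule: finite_ne_induct)
  case (singleton i)
  note [measurable] = singleton
  have "(\<integral>\<^sup>+x. h (\<Sum>j\<in>{i}. \<bar>x j\<bar>) \<partial>Pi\<^sub>M {i} (\<lambda>_. lborel)) = (\<integral>\<^sup>+x. h \<bar>x\<bar> \<partial>lborel)"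
    using lborel_family.product_nn_integral_singleton[of "\<lambda>x. h \<bar>x\<bar>" i] by simp
  then show ?case
    by (simp add: nn_integral_abs)
next
  case (insert i I)
  note [measurable] = insert.prems
  obtain m where m: "card I = Suc m"
    using insert.hyps by (metis card_gt_0_iff gr0_implies_Suc)
  let ?C = "ennreal (2 ^ card I / fact (card I - 1))"
  have "(\<integral>\<^sup>+x. h (\<Sum>j\<in>insert i I. \<bar>x j\<bar>) \<partial>Pi\<^sub>M (insert i I) (\<lambda>_. lborel)) =
      (\<integral>\<^sup>+y. \<integral>\<^sup>+x. h (\<Sum>j\<in>insert i I. \<bar>(x(i := y)) j\<bar>) \<partial>Pi\<^sub>M I (\<lambda>_. lborel) \<partial>lborel)"
    using insert.hyps by (intro lborel_family.product_nn_integral_insert_rev) auto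
  also have "\<dots> = (\<integral>\<^sup>+y. \<integral>\<^sup>+x. h (\<bar>y\<bar> + (\<Sum>j\<in>I. \<bar>x j\<bar>)) \<partial>Pi\<^sub>M I (\<lambda>_. lborel) \<partial>lborel)"
  proof (intro nn_integral_cong arg_cong[where f=h])
    fix x y
    have "(\<Sum>j\<in>I. \<bar>(x(i := y)) j\<bar>) = (\<Sum>j\<in>I. \<bar>x j\<bar>)"
      using insert.hyps by (intro sum.cong) auto
    then show "(\<Sum>j\<in>insert i I. \<bar>(x(i := y)) j\<bar>) = \<bar>y\<bar> + (\<Sum>j\<in>I. \<bar>x j\<bar>)"
      using insert.hyps by simp
  qed
  also have "\<dots> = (\<integral>\<^sup>+y. ?C * (\<integral>\<^sup>+\<rho>. h (\<bar>y\<bar> + \<rho>) * (ennreal (\<rho> ^ m) * indicator {0..} \<rho>) \<partial>lborel) \<partial>lborel)"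
    using insert.IH[of "\<lambda>s. h (\<bar>y\<bar> + s)" for y] m by (intro nn_integral_cong) simp
  also have "\<dots> = ?C * (\<integral>\<^sup>+y. \<integral>\<^sup>+\<rho>. h (\<bar>y\<bar> + \<rho>) * (ennreal (\<rho> ^ m) * indicator {0..} \<rho>) \<partial>lborel \<partial>lborel)"
    by (intro nn_integral_cmult) measurable
  also have "(\<integral>\<^sup>+y. \<integral>\<^sup>+\<rho>. h (\<bar>y\<bar> + \<rho>) * (ennreal (\<rho> ^ m) * indicator {0..} \<rho>) \<partial>lborel \<partial>lborel)
      = (\<integral>\<^sup>+\<rho>. \<integral>\<^sup>+y. h (\<bar>y\<bar> + \<rho>) * (ennreal (\<rho> ^ m) * indicator {0..} \<rho>) \<partial>lborel \<partial>lborel)"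
    by (rule lborel_pair.Fubini') measurable
  \<comment> \<open>The factor 2 accounts for the sign of \<open>y\<close>, and
    \<open>s = y + \<rho>\<close> is the new total norm: \<open>y \<ge> 0\<close> becomes
    \<open>\<rho> \<le> s\<close>. After exchanging the integrals, the integral over
    \<open>\<rho>\<close> is that of a power on \<open>{0..s}\<close>.\<close>
  also have "\<dots> = (\<integral>\<^sup>+\<rho>. 2 * (\<integral>\<^sup>+s. h s * indicator {0..} s * (ennreal (\<rho> ^ m) * indicator {0..s} \<rho>) \<partial>lborel) \<partial>lborel)"
  proof (rule nn_integral_cong)
    fix \<rho> :: real
    have "(\<integral>\<^sup>+y. h (\<bar>y\<bar> + \<rho>) * (ennreal (\<rho> ^ m) * indicator {0..} \<rho>) \<partial>lborel)
      = 2 * (\<integral>\<^sup>+y. h (y + \<rho>) * (ennreal (\<rho> ^ m) * indicator {0..} \<rho>) * indicator {0..} y \<partial>lborel)"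
      using nn_integral_abs[of "\<lambda>y. h (y + \<rho>) * (ennreal (\<rho> ^ m) * indicator {0..} \<rho>)"] by simp
    also have "(\<integral>\<^sup>+y. h (y + \<rho>) * (ennreal (\<rho> ^ m) * indicator {0..} \<rho>) * indicator {0..} y \<partial>lborel)
      = (\<integral>\<^sup>+s. h s * indicator {0..} s * (ennreal (\<rho> ^ m) * indicator {0..s} \<rho>) \<partial>lborel)"
      by (subst nn_integral_real_affine[where c=1 and t="-\<rho>"])
        (auto intro!: nn_integral_cong split: split_indicator)
    finally show "(\<integral>\<^sup>+y. h (\<bar>y\<bar> + \<rho>) * (ennreal (\<rho> ^ m) * indicator {0..} \<rho>) \<partial>lborel)
      = 2 * (\<integral>\<^sup>+s. h s * indicator {0..} s * (ennreal (\<rho> ^ m) * indicator {0..s} \<rho>) \<partial>lborel)" .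
  qed
  also have "\<dots> = 2 * (\<integral>\<^sup>+\<rho>. \<integral>\<^sup>+s. h s * indicator {0..} s * (ennreal (\<rho> ^ m) * indicator {0..s} \<rho>) \<partial>lborel \<partial>lborel)"
  proof (rule nn_integral_cmult)
    have [measurable]: "Measurable.pred (borel \<Otimes>\<^sub>M borel) (\<lambda>x::real \<times> real. fst x \<in> {0..snd x})"
      unfolding atLeastAtMost_iff by measurable
    show "(\<lambda>\<rho>. \<integral>\<^sup>+s. h s * indicator {0..} s * (ennreal (\<rho> ^ m) * indicator {0..s} \<rho>) \<partial>lborel)
        \<in> borel_measurable lborel"
      by measurable
  qed
  also have "(\<integral>\<^sup>+\<rho>. \<integral>\<^sup>+s. h s * indicator {0..} s * (ennreal (\<rho> ^ m) * indicator {0..s} \<rho>) \<partial>lborel \<partial>lborel)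
      = (\<integral>\<^sup>+s. \<integral>\<^sup>+\<rho>. h s * indicator {0..} s * (ennreal (\<rho> ^ m) * indicator {0..s} \<rho>) \<partial>lborel \<partial>lborel)"
  proof (rule lborel_pair.Fubini')
    have [measurable]: "Measurable.pred (borel \<Otimes>\<^sub>M borel) (\<lambda>x::real \<times> real. snd x \<in> {0..fst x})"
      unfolding atLeastAtMost_iff by measurable
    show "(\<lambda>(s, \<rho>). h s * indicator {0..} s * (ennreal (\<rho> ^ m) * indicator {0..s} \<rho>))
        \<in> borel_measurable (lborel \<Otimes>\<^sub>M lborel)"
      by measurable
  qed
  also have "\<dots> = (\<integral>\<^sup>+s. ennreal (1 / real (Suc m)) * (h s * (ennreal (s ^ Suc m) * indicator {0..} s)) \<partial>lborel)"
  proof (rule nn_integral_cong)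
    fix s :: real
    have "(\<integral>\<^sup>+\<rho>. h s * indicator {0..} s * (ennreal (\<rho> ^ m) * indicator {0..s} \<rho>) \<partial>lborel)
       = h s * indicator {0..} s * (\<integral>\<^sup>+\<rho>. ennreal (\<rho> ^ m) * indicator {0..s} \<rho> \<partial>lborel)"
      by (intro nn_integral_cmult) measurable
    also have "\<dots> = h s * indicator {0..} s * ennreal (1 / real (Suc m) * s ^ Suc m)"
      by (cases "0 \<le> s") (auto simp: nn_integral_power_Icc simp del: power_Suc)
    also have "ennreal (1 / real (Suc m) * s ^ Suc m) = ennreal (1 / real (Suc m)) * ennreal (s ^ Suc m)"
      by (rule ennreal_mult') simp
    also have "h s * indicator {0..} s * \<dots> = ennreal (1 / real (Suc m)) * (h s * (ennreal (s ^ Suc m) * indicator {0..} s))"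
      by (simp only: mult_ac)
    finally show "(\<integral>\<^sup>+\<rho>. h s * indicator {0..} s * (ennreal (\<rho> ^ m) * indicator {0..s} \<rho>) \<partial>lborel)
      = ennreal (1 / real (Suc m)) * (h s * (ennreal (s ^ Suc m) * indicator {0..} s))" .
  qed
  also have "\<dots> = ennreal (1 / real (Suc m)) * (\<integral>\<^sup>+s. h s * (ennreal (s ^ Suc m) * indicator {0..} s) \<partial>lborel)"
    by (intro nn_integral_cmult) measurable
  finally have "(\<integral>\<^sup>+x. h (\<Sum>j\<in>insert i I. \<bar>x j\<bar>) \<partial>Pi\<^sub>M (insert i I) (\<lambda>_. lborel)) =
      (?C * (ennreal 2 * ennreal (1 / real (Suc m)))) * (\<integral>\<^sup>+s. h s * (ennreal (s ^ Suc m) * indicator {0..} s) \<partial>lborel)"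
    by (simp only: mult.assoc ennreal_numeral)
  also have "?C * (ennreal 2 * ennreal (1 / real (Suc m))) = ennreal (2 ^ card I / fact (card I - 1) * (2 * (1 / real (Suc m))))"
    by (simp only: ennreal_mult'[symmetric] zero_le_numeral zero_le_power divide_nonneg_nonneg fact_ge_zero)
  also have "2 ^ card I / fact (card I - 1) * (2 * (1 / real (Suc m))) = 2 ^ card (insert i I) / fact (card (insert i I) - 1)"
    using insert.hyps m by (simp add: mult.commute)
  finally show ?case
    using insert.hyps m by simp
qed

lemma l1_ball_unit_volume:
  assumes "0 < d"
  shows "(\<integral>\<^sup>+u. indicator {..1} (l1_norm d u) \<partial>lebesgue_Rd d) = ennreal (2 ^ d / fact d)"
proof -
  obtain m where m: "d = Suc m" using assms by (cases d) auto
  have "(\<integral>\<^sup>+u. indicator {..1} (l1_norm d u) \<partial>lebesgue_Rd d)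
      = ennreal (2 ^ d / fact m) * (\<integral>\<^sup>+\<rho>. indicator {..1} \<rho> * (ennreal (\<rho> ^ m) * indicator {0..} \<rho>) \<partial>lborel)"
    using nn_integral_l1_polar[of "{..<d}" "indicator {..1}"]
    unfolding lebesgue_Rd_def l1_norm_def by (simp add: m lessThan_empty_iff)
  also have "(\<integral>\<^sup>+\<rho>. indicator {..1} \<rho> * (ennreal (\<rho> ^ m) * indicator {0..} \<rho>) \<partial>lborel) =
      (\<integral>\<^sup>+\<rho>. ennreal (\<rho> ^ m) * indicator {0..1} \<rho> \<partial>lborel)"
    by (intro nn_integral_cong) (auto split: split_indicator)
  also have "\<dots> = ennreal (1 / real (Suc m))"
    by (simp add: nn_integral_power_Icc del: of_nat_Suc)
  also have "ennreal (2 ^ d / fact m) * ennreal (1 / real (Suc m)) = ennreal (2 ^ d / fact m * (1 / real (Suc m)))"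
    by (rule ennreal_mult'[symmetric]) simp
  also have "2 ^ d / fact m * (1 / real (Suc m)) = 2 ^ d / fact d"
    by (simp add: m mult.commute)
  finally show ?thesis .
qed

text \<open>The link between nonnegative integrals, in which the proof computes, and the iterated
  Lebesgue integral of the statement. Boundedness on the triangle makes the inner and outer
  integrands integrable, so that neither integral takes the default value 0.\<close>

lemma nn_integral_triangle_eq_LBINT:
  fixes g :: "real \<Rightarrow> real \<Rightarrow> real"
  assumes [measurable]: "(\<lambda>(u, \<rho>). g u \<rho>) \<in> borel_measurable (borel \<Otimes>\<^sub>M borel)"
    and g: "\<And>u \<rho>. 0 \<le> \<rho> \<Longrightarrow> \<bar>u\<bar> + \<rho> \<le> 1 \<Longrightarrow> 0 \<le> g u \<rho> \<and> g u \<rho> \<le> M"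
  shows "(\<integral>\<^sup>+u. \<integral>\<^sup>+\<rho>. ennreal (g u \<rho>) * indicator {..1} (\<bar>u\<bar> + \<rho>) * indicator {0..} \<rho> \<partial>lborel \<partial>lborel)
    = ennreal (LBINT u:{-1..1}. LBINT \<rho>:{0..1 - \<bar>u\<bar>}. g u \<rho>)"
proof -
  have M: "0 \<le> M" using g[of 0 0] by simp
  define G where "G u \<rho> = (if 0 \<le> \<rho> \<and> \<bar>u\<bar> + \<rho> \<le> 1 then g u \<rho> else 0)" for u \<rho>
  have [measurable]: "(\<lambda>(u, \<rho>). G u \<rho>) \<in> borel_measurable (borel \<Otimes>\<^sub>M borel)"
    unfolding G_def by measurable
  have [measurable]: "G u \<in> borel_measurable borel" for u
    using measurable_compose_Pair1[of u borel "\<lambda>(u, \<rho>). G u \<rho>" borel borel] by simp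
  have G0: "0 \<le> G u \<rho>" and G1: "G u \<rho> \<le> M * indicator {0..1} \<rho>" for u \<rho>
    using g[of \<rho> u] M by (auto simp: G_def split: split_indicator)
  have G2: "G u \<rho> = 0" if "u \<notin> {-1..1}" for u \<rho>
    using that by (auto simp: G_def)
  have intG: "integrable lborel (G u)" for u
    by (rule Bochner_Integration.integrable_bound[where f="\<lambda>\<rho>. M * indicator {0..1} \<rho>"])
      (use G0 G1 M in auto)
  define L where "L u = (LBINT \<rho>. G u \<rho>)" for u
  have [measurable]: "L \<in> borel_measurable borel"
    unfolding L_def by measurable
  have L0: "0 \<le> L u" for u
    unfolding L_def using G0 by simp
  have L1: "L u \<le> M * indicator {-1..1} u" for u
  proof (cases "u \<in> {-1..1}")
    case True
    have "L u \<le> (LBINT \<rho>::real. M * indicator {0..1} \<rho>)"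
      unfolding L_def using intG G1 by (intro Bochner_Integration.integral_mono) auto
    then show ?thesis using True by simp
  qed (simp add: L_def G2)
  have intL: "integrable lborel L"
    by (rule Bochner_Integration.integrable_bound[where f="\<lambda>u. M * indicator {-1..1} u"])
      (use L0 L1 M in auto)
  have "(\<integral>\<^sup>+u. \<integral>\<^sup>+\<rho>. ennreal (g u \<rho>) * indicator {..1} (\<bar>u\<bar> + \<rho>) * indicator {0..} \<rho> \<partial>lborel \<partial>lborel)
      = (\<integral>\<^sup>+u. \<integral>\<^sup>+\<rho>. ennreal (G u \<rho>) \<partial>lborel \<partial>lborel)"
    by (intro nn_integral_cong) (auto simp: G_def split: split_indicator)
  also have "\<dots> = (\<integral>\<^sup>+u. ennreal (L u) \<partial>lborel)"
    unfolding L_def using intG G0 by (intro nn_integral_cong nn_integral_eq_integral) auto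
  also have "\<dots> = ennreal (LBINT u. L u)"
    using intL L0 by (intro nn_integral_eq_integral) auto
  also have "(LBINT u. L u) = (LBINT u:{-1..1}. LBINT \<rho>:{0..1 - \<bar>u\<bar>}. g u \<rho>)"
    unfolding set_lebesgue_integral_def
  proof (intro Bochner_Integration.integral_cong refl)
    fix u
    have "(LBINT \<rho>. indicat_real {0..1 - \<bar>u\<bar>} \<rho> *\<^sub>R g u \<rho>) = L u"
      unfolding L_def by (intro Bochner_Integration.integral_cong) (auto simp: G_def split: split_indicator)
    moreover have "indicat_real {-1..1} u *\<^sub>R L u = L u"
      using L0[of u] L1[of u] by (auto split: split_indicator)
    ultimately show "L u = indicat_real {-1..1} u *\<^sub>R (LBINT \<rho>. indicat_real {0..1 - \<bar>u\<bar>} \<rho> *\<^sub>R g u \<rho>)"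
      by simp
  qed
  finally show ?thesis .
qed

section \<open>Moduli of continuity\<close>

text \<open>Nothing is known about \<open>\<omega>\<close> at negative arguments. Extending by the
  value at 0 gives a function that is monotone, continuous and hence measurable on the whole
  line.\<close>

definition extend0 :: "(real \<Rightarrow> real) \<Rightarrow> real \<Rightarrow> real" where
  "extend0 \<omega> s = \<omega> (max 0 s)"

lemma extend0_eq [simp]: "0 \<le> s \<Longrightarrow> extend0 \<omega> s = \<omega> s"
  by (simp add: extend0_def)

context
  fixes \<omega> :: "real \<Rightarrow> real"
  assumes \<omega>: "modulus_of_continuity \<omega>"
begin

lemma modulus_nonneg: "0 \<le> s \<Longrightarrow> 0 \<le> \<omega> s"
  and modulus_mono: "0 \<le> s \<Longrightarrow> s \<le> t \<Longrightarrow> \<omega> s \<le> \<omega> t"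
  and modulus_subadd: "0 \<le> s \<Longrightarrow> 0 \<le> t \<Longrightarrow> \<omega> (s + t) \<le> \<omega> s + \<omega> t"
  and modulus_0: "\<omega> 0 = 0"
  using \<omega> by (auto simp: modulus_of_continuity_def mono_on_def)

text \<open>If \<open>\<omega> t = 0\<close>, then subadditivity gives
  \<open>\<omega> (n t) = 0\<close> for all \<open>n\<close>, and monotonicity makes
  \<open>\<omega>\<close> vanish identically.\<close>

lemma modulus_pos:
  assumes t: "0 < t"
  shows "0 < \<omega> t"
proof (rule ccontr)
  assume "\<not> 0 < \<omega> t"
  then have \<omega>t: "\<omega> t = 0" using modulus_nonneg[of t] t by simp
  have zero: "\<omega> (real n * t) \<le> 0" for n
  proof (induction n)
    case (Suc n)
    have "\<omega> (real n * t + t) \<le> \<omega> (real n * t) + \<omega> t"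
      using t by (intro modulus_subadd) auto
    then show ?case using Suc \<omega>t by (simp add: algebra_simps)
  qed (simp add: modulus_0)
  obtain s where s: "0 \<le> s" "\<omega> s \<noteq> 0"
    using \<omega> by (auto simp: modulus_of_continuity_def)
  obtain n where "s \<le> real n * t"
    using ex_less_of_nat_mult[OF t, of s] by (auto intro: less_imp_le)
  then have "\<omega> s \<le> 0" using modulus_mono[OF s(1)] zero[of n] by force
  then show False using s modulus_nonneg[of s] by simp
qed

lemma modulus_abs_diff:
  assumes "0 \<le> a" "0 \<le> b"
  shows "\<bar>\<omega> a - \<omega> b\<bar> \<le> \<omega> \<bar>a - b\<bar>"
proof -
  have "\<omega> a - \<omega> b \<le> \<omega> \<bar>a - b\<bar>" if "0 \<le> a" "0 \<le> b" for a b
  proof -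
    have "\<omega> a \<le> \<omega> (b + \<bar>a - b\<bar>)" using that by (intro modulus_mono) auto
    also have "\<dots> \<le> \<omega> b + \<omega> \<bar>a - b\<bar>" using that by (intro modulus_subadd) auto
    finally show ?thesis by simp
  qed
  from this[of a b] this[of b a] assms show ?thesis
    by (simp add: abs_le_iff abs_minus_commute)
qed

lemma continuous_extend0: "continuous_on UNIV (extend0 \<omega>)"
proof -
  have "continuous_on UNIV (\<omega> \<circ> max 0)"
    using \<omega> by (intro continuous_on_compose continuous_intros)
      (auto simp: modulus_of_continuity_def intro: continuous_on_subset)
  then show ?thesis by (simp add: extend0_def[abs_def] comp_def)
qed

lemma extend0_measurable [measurable]: "extend0 \<omega> \<in> borel_measurable borel"
  using continuous_extend0 by (rule borel_measurable_continuous_onI)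

lemma mono_extend0: "mono (extend0 \<omega>)"
  by (auto intro!: monoI modulus_mono simp: extend0_def)

lemma extend0_nonneg: "0 \<le> extend0 \<omega> s"
  by (simp add: extend0_def modulus_nonneg)

lemma modulus_tendsto_0: "0 < e \<Longrightarrow> \<exists>s>0. \<omega> s < e"
proof -
  assume e: "0 < e"
  have "isCont (extend0 \<omega>) 0"
    using continuous_extend0 by (simp add: continuous_on_eq_continuous_at)
  then obtain s where "0 < s" "\<And>x. \<bar>x\<bar> < s \<Longrightarrow> \<bar>extend0 \<omega> x - extend0 \<omega> 0\<bar> < e"
    using e unfolding continuous_at_eps_delta by (metis dist_real_def diff_zero)
  from this(1) this(2)[of "s/2"] show ?thesis
    by (intro exI[of _ "s/2"]) (auto simp: modulus_0)
qed

end

section \<open>Balls centered on the first axis\<close>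

abbreviation on_axis :: "real \<Rightarrow> nat \<Rightarrow> real" where
  "on_axis a \<equiv> \<lambda>i. if i = 0 then a else 0"

lemma l1_norm_axis_affine:
  assumes "0 < d" "0 \<le> r"
  shows "l1_norm d (\<lambda>i. on_axis a i + r * u i) = \<bar>a + r * u 0\<bar> + r * (\<Sum>i=1..<d. \<bar>u i\<bar>)"
proof -
  have "{..<d} - {0} = {1..<d}" by auto
  then show ?thesis
    using assms by (simp add: l1_norm_remove[of 0] abs_mult sum_distrib_left)
qed

lemma l1_norm_split: "0 < d \<Longrightarrow> l1_norm d u = \<bar>u 0\<bar> + (\<Sum>i=1..<d. \<bar>u i\<bar>)"
  using l1_norm_axis_affine[of d 1 0 u] by simp

text \<open>The center has only coordinate 0, so the integrand depends on the remaining
  \<open>d - 1\<close> coordinates through their l1 norm alone. Polar coordinates in these give the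
  constant and the exponent \<open>d - 2\<close>.\<close>

lemma ball_int_axis_polar:
  assumes d: "2 \<le> d" and r: "0 \<le> r" and [measurable]: "\<phi> \<in> borel_measurable borel"
  shows "ball_int d \<phi> (on_axis a) r = ennreal (2 ^ (d - 1) / fact (d - 2)) *
    (\<integral>\<^sup>+u. \<integral>\<^sup>+\<rho>. \<phi> (\<bar>a + r * u\<bar> + r * \<rho>) * ennreal (\<rho> ^ (d - 2)) * indicator {..1} (\<bar>u\<bar> + \<rho>) *
      indicator {0..} \<rho> \<partial>lborel \<partial>lborel)"
proof -
  let ?M = "\<lambda>_::nat. lborel :: real measure"
  let ?h = "\<lambda>u \<rho>. \<phi> (\<bar>a + r * u\<bar> + r * \<rho>) * indicator {..1} (\<bar>u\<bar> + \<rho>)"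
  have ins: "{..<d} = insert 0 {1..<d}" using d by auto
  have norm: "\<phi> (l1_norm d (\<lambda>i. on_axis a i + r * u i)) * indicator {..1} (l1_norm d u)
      = ?h (u 0) (\<Sum>i=1..<d. \<bar>u i\<bar>)" for u
    unfolding l1_norm_axis_affine[OF order.strict_trans2[OF _ d, OF zero_less_numeral] r]
    using d by (simp add: l1_norm_split)
  have "ball_int d \<phi> (on_axis a) r = (\<integral>\<^sup>+u. ?h (u 0) (\<Sum>i=1..<d. \<bar>u i\<bar>) \<partial>Pi\<^sub>M (insert 0 {1..<d}) ?M)"
    unfolding ball_int_def lebesgue_Rd_def norm ins ..
  also have "\<dots> = (\<integral>\<^sup>+u. \<integral>\<^sup>+x. ?h ((x(0 := u)) 0) (\<Sum>i=1..<d. \<bar>(x(0 := u)) i\<bar>) \<partial>Pi\<^sub>M {1..<d} ?M \<partial>lborel)"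
    by (rule lborel_family.product_nn_integral_insert_rev) auto
  also have "\<dots> = (\<integral>\<^sup>+u. \<integral>\<^sup>+x. ?h u (\<Sum>i=1..<d. \<bar>x i\<bar>) \<partial>Pi\<^sub>M {1..<d} ?M \<partial>lborel)"
  proof (intro nn_integral_cong)
    fix x :: "nat \<Rightarrow> real" and u
    have "(\<Sum>i=1..<d. \<bar>(x(0 := u)) i\<bar>) = (\<Sum>i=1..<d. \<bar>x i\<bar>)"
      by (intro sum.cong) auto
    then show "?h ((x(0 := u)) 0) (\<Sum>i=1..<d. \<bar>(x(0 := u)) i\<bar>) = ?h u (\<Sum>i=1..<d. \<bar>x i\<bar>)"
      by simp
  qed
  also have "\<dots> = (\<integral>\<^sup>+u. ennreal (2 ^ (d - 1) / fact (d - 2)) *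
      (\<integral>\<^sup>+\<rho>. ?h u \<rho> * (ennreal (\<rho> ^ (d - 2)) * indicator {0..} \<rho>) \<partial>lborel) \<partial>lborel)"
  proof (rule nn_integral_cong)
    fix u
    show "(\<integral>\<^sup>+x. ?h u (\<Sum>i=1..<d. \<bar>x i\<bar>) \<partial>Pi\<^sub>M {1..<d} ?M) = ennreal (2 ^ (d - 1) / fact (d - 2)) *
      (\<integral>\<^sup>+\<rho>. ?h u \<rho> * (ennreal (\<rho> ^ (d - 2)) * indicator {0..} \<rho>) \<partial>lborel)"
      using nn_integral_l1_polar[of "{1..<d}" "?h u"] d
      by (simp add: numeral_2_eq_2)
  qed
  also have "\<dots> = ennreal (2 ^ (d - 1) / fact (d - 2)) *
    (\<integral>\<^sup>+u. \<integral>\<^sup>+\<rho>. ?h u \<rho> * (ennreal (\<rho> ^ (d - 2)) * indicator {0..} \<rho>) \<partial>lborel \<partial>lborel)"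
    by (intro nn_integral_cmult) measurable
  finally show ?thesis
    by (simp only: mult_ac)
qed

text \<open>For \<open>0 \<le> R \<le> 1\<close> this is the average of \<open>\<omega>\<close> of
  the norm over the ball with center \<open>t (1 - R) e_1\<close> and radius \<open>t R\<close>, as
  \<open>ball_int_axis_eq_radial_average\<close> shows for \<open>0 < t\<close> and
  \<open>2 \<le> d\<close>.\<close>

definition radial_average :: "(real \<Rightarrow> real) \<Rightarrow> nat \<Rightarrow> real \<Rightarrow> real \<Rightarrow> real" where
  "radial_average \<omega> d t R = real d * (real d - 1) / 2 *
     (LBINT u:{-1..1}. LBINT \<rho>:{0..1 - \<bar>u\<bar>}. \<omega> (t * (\<bar>(1 - R) + R * u\<bar> + R * \<rho>)) * \<rho> ^ (d - 2))"

lemma axis_norm_le: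
  fixes R u \<rho> :: real
  assumes "0 \<le> R" "R \<le> 1" "0 \<le> \<rho>" "\<bar>u\<bar> + \<rho> \<le> 1"
  shows "\<bar>(1 - R) + R * u\<bar> + R * \<rho> \<le> 1"
proof -
  have "\<bar>(1 - R) + R * u\<bar> \<le> \<bar>1 - R\<bar> + \<bar>R * u\<bar>" by (rule abs_triangle_ineq)
  moreover have "R * (\<bar>u\<bar> + \<rho>) \<le> R * 1" using assms by (intro mult_left_mono) auto
  ultimately show ?thesis using assms by (simp add: abs_mult algebra_simps)
qed

lemma axis_norm_scale:
  fixes t R u \<rho> :: real
  assumes "0 \<le> t"
  shows "\<bar>t * (1 - R) + t * R * u\<bar> + t * R * \<rho> = t * (\<bar>(1 - R) + R * u\<bar> + R * \<rho>)"
proof -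
  have "t * (1 - R) + t * R * u = t * ((1 - R) + R * u)" by (simp add: algebra_simps)
  then have "\<bar>t * (1 - R) + t * R * u\<bar> = t * \<bar>(1 - R) + R * u\<bar>"
    using assms by (simp only: abs_mult abs_of_nonneg)
  then show ?thesis by (simp add: algebra_simps)
qed

lemma nn_integral_radial:
  assumes \<omega>: "modulus_of_continuity \<omega>" and t: "0 < t" and R: "0 \<le> R" "R \<le> 1"
  shows "(\<integral>\<^sup>+u. \<integral>\<^sup>+\<rho>. ennreal (extend0 \<omega> (t * (\<bar>(1 - R) + R * u\<bar> + R * \<rho>))) *
      ennreal (\<rho> ^ n) * indicator {..1} (\<bar>u\<bar> + \<rho>) * indicator {0..} \<rho> \<partial>lborel \<partial>lborel)
    = ennreal (LBINT u:{-1..1}. LBINT \<rho>:{0..1 - \<bar>u\<bar>}. \<omega> (t * (\<bar>(1 - R) + R * u\<bar> + R * \<rho>)) * \<rho> ^ n)"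
proof -
  note [measurable] = extend0_measurable[OF \<omega>]
  let ?g = "\<lambda>u \<rho>. extend0 \<omega> (t * (\<bar>(1 - R) + R * u\<bar> + R * \<rho>)) * \<rho> ^ n"
  have bound: "0 \<le> ?g u \<rho> \<and> ?g u \<rho> \<le> extend0 \<omega> t * 1" if "0 \<le> \<rho>" "\<bar>u\<bar> + \<rho> \<le> 1" for u \<rho>
  proof -
    have "extend0 \<omega> (t * (\<bar>(1 - R) + R * u\<bar> + R * \<rho>)) \<le> extend0 \<omega> (t * 1)"
      using axis_norm_le[OF R that] t by (intro monoD[OF mono_extend0[OF \<omega>]] mult_left_mono) auto
    moreover have "\<rho> ^ n \<le> 1" using that by (intro power_le_one) auto
    ultimately show ?thesis
      using that extend0_nonneg[OF \<omega>] by (intro conjI mult_nonneg_nonneg mult_mono) auto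
  qed
  have "(\<integral>\<^sup>+u. \<integral>\<^sup>+\<rho>. ennreal (extend0 \<omega> (t * (\<bar>(1 - R) + R * u\<bar> + R * \<rho>))) *
      ennreal (\<rho> ^ n) * indicator {..1} (\<bar>u\<bar> + \<rho>) * indicator {0..} \<rho> \<partial>lborel \<partial>lborel)
    = (\<integral>\<^sup>+u. \<integral>\<^sup>+\<rho>. ennreal (?g u \<rho>) * indicator {..1} (\<bar>u\<bar> + \<rho>) * indicator {0..} \<rho> \<partial>lborel \<partial>lborel)"
    unfolding ennreal_mult'[OF extend0_nonneg[OF \<omega>]] ..
  also have "\<dots> = ennreal (LBINT u:{-1..1}. LBINT \<rho>:{0..1 - \<bar>u\<bar>}. ?g u \<rho>)"
    by (rule nn_integral_triangle_eq_LBINT[OF _ bound]) (simp_all, measurable)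
  also have "(LBINT u:{-1..1}. LBINT \<rho>:{0..1 - \<bar>u\<bar>}. ?g u \<rho>) =
      (LBINT u:{-1..1}. LBINT \<rho>:{0..1 - \<bar>u\<bar>}. \<omega> (t * (\<bar>(1 - R) + R * u\<bar> + R * \<rho>)) * \<rho> ^ n)"
  proof -
    have "(LBINT \<rho>:{0..1 - \<bar>u\<bar>}. ?g u \<rho>) =
        (LBINT \<rho>:{0..1 - \<bar>u\<bar>}. \<omega> (t * (\<bar>(1 - R) + R * u\<bar> + R * \<rho>)) * \<rho> ^ n)" for u
      using t R by (intro set_lebesgue_integral_cong) auto
    then show ?thesis by (simp only:)
  qed
  finally show ?thesis .
qed

lemma ball_int_axis_eq_radial_average:
  assumes \<omega>: "modulus_of_continuity \<omega>" and d: "2 \<le> d" and t: "0 < t" and R: "0 \<le> R" "R \<le> 1"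
  shows "ball_int d (\<lambda>s. ennreal (extend0 \<omega> s)) (on_axis (t * (1 - R))) (t * R) / ennreal (2 ^ d / fact d)
    = ennreal (radial_average \<omega> d t R)"
proof -
  note [measurable] = extend0_measurable[OF \<omega>]
  have "ball_int d (\<lambda>s. ennreal (extend0 \<omega> s)) (on_axis (t * (1 - R))) (t * R) =
      ennreal (2 ^ (d - 1) / fact (d - 2)) *
      ennreal (LBINT u:{-1..1}. LBINT \<rho>:{0..1 - \<bar>u\<bar>}. \<omega> (t * (\<bar>(1 - R) + R * u\<bar> + R * \<rho>)) * \<rho> ^ (d - 2))"
    using d t R nn_integral_radial[OF \<omega> t R, of "d - 2"]
    by (subst ball_int_axis_polar) (auto simp only: axis_norm_scale less_imp_le mult_nonneg_nonneg measurable_compose[OF extend0_measurable[OF \<omega>] measurable_ennreal])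
  also have "\<dots> = ennreal (2 ^ (d - 1) / fact (d - 2) *
      (LBINT u:{-1..1}. LBINT \<rho>:{0..1 - \<bar>u\<bar>}. \<omega> (t * (\<bar>(1 - R) + R * u\<bar> + R * \<rho>)) * \<rho> ^ (d - 2)))"
    by (rule ennreal_mult'[symmetric]) simp
  \<comment> \<open>The origin of \<open>d (d - 1) / 2\<close>: the polar constant of
    \<open>d - 1\<close> coordinates divided by the volume of the unit ball in \<open>d\<close>
    dimensions.\<close>
  also have "2 ^ (d - 1) / fact (d - 2) = real d * (real d - 1) / 2 * (2 ^ d / fact d)"
  proof -
    obtain m where m: "d = Suc (Suc m)" using d by (metis add_2_eq_Suc le_Suc_ex)
    have "fact d = real d * (real d - 1) * fact (d - 2)" "(2::real) ^ d = 2 * 2 ^ (d - 1)"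
      by (simp_all add: m)
    moreover have "real d \<noteq> 0" "real d - 1 \<noteq> 0" using d by auto
    ultimately show ?thesis by simp
  qed
  finally have eq: "ball_int d (\<lambda>s. ennreal (extend0 \<omega> s)) (on_axis (t * (1 - R))) (t * R) =
      ennreal (radial_average \<omega> d t R * (2 ^ d / fact d))"
    by (simp only: radial_average_def mult_ac)
  have "ennreal (radial_average \<omega> d t R * (2 ^ d / fact d)) = ennreal (radial_average \<omega> d t R) * ennreal (2 ^ d / fact d)"
    by (rule ennreal_mult'') simp
  then show ?thesis
    unfolding eq by (simp add: mult_divide_eq_ennreal)
qed

section \<open>Averages in coordinates relative to the ball\<close>

lemma l1_ball_measurable [measurable]: "l1_ball d c r \<in> sets (lebesgue_Rd d)"
proof -
  have [measurable]: "(\<lambda>y. l1_norm d (\<lambda>i. y i - c i)) \<in> borel_measurable (lebesgue_Rd d)"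
    using l1_norm_affine_measurable[of d "\<lambda>i. - c i" 1] by simp
  have "l1_ball d c r = {y \<in> space (lebesgue_Rd d). l1_norm d (\<lambda>i. y i - c i) \<le> r}"
    by (simp add: l1_ball_def space_lebesgue_Rd)
  then show ?thesis by simp
qed

text \<open>The factor \<open>r ^ d\<close> of the substitution occurs in the integral and in the
  volume and cancels. Averages over balls of different sizes thus become integrals over the same
  unit ball and can be compared point by point.\<close>

lemma l1_ball_average:
  assumes d: "0 < d" and r: "0 < r" and g [measurable]: "g \<in> borel_measurable (lebesgue_Rd d)"
  shows "(\<integral>\<^sup>+y\<in>l1_ball d c r. g y \<partial>lebesgue_Rd d) / emeasure (lebesgue_Rd d) (l1_ball d c r) =
    (\<integral>\<^sup>+u. g (\<lambda>i\<in>{..<d}. c i + r * u i) * indicator {..1} (l1_norm d u) \<partial>lebesgue_Rd d)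
      / ennreal (2 ^ d / fact d)"
proof -
  have ball: "(\<integral>\<^sup>+y\<in>l1_ball d c r. g y \<partial>lebesgue_Rd d) = ennreal (r ^ d) *
      (\<integral>\<^sup>+u. g (\<lambda>i\<in>{..<d}. c i + r * u i) * indicator {..1} (l1_norm d u) \<partial>lebesgue_Rd d)"
    if [measurable]: "g \<in> borel_measurable (lebesgue_Rd d)" for g
  proof -
    have "(\<integral>\<^sup>+y\<in>l1_ball d c r. g y \<partial>lebesgue_Rd d) = ennreal (r ^ d) * (\<integral>\<^sup>+u.
        g (\<lambda>i\<in>{..<d}. c i + r * u i) * indicator (l1_ball d c r) (\<lambda>i\<in>{..<d}. c i + r * u i) \<partial>lebesgue_Rd d)"
      using nn_integral_PiM_lborel_affine[of "{..<d}" r "\<lambda>y. g y * indicator (l1_ball d c r) y" c] r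
      unfolding lebesgue_Rd_def[symmetric] by simp
    also have "(\<integral>\<^sup>+u. g (\<lambda>i\<in>{..<d}. c i + r * u i) *
          indicator (l1_ball d c r) (\<lambda>i\<in>{..<d}. c i + r * u i) \<partial>lebesgue_Rd d)
        = (\<integral>\<^sup>+u. g (\<lambda>i\<in>{..<d}. c i + r * u i) * indicator {..1} (l1_norm d u) \<partial>lebesgue_Rd d)"
    proof (intro nn_integral_cong arg_cong2[where f="(*)"] refl)
      fix u
      have "l1_norm d (\<lambda>i. (\<lambda>i\<in>{..<d}. c i + r * u i) i - c i) = r * l1_norm d u"
        using r by (simp add: l1_norm_def abs_mult sum_distrib_left)
      then show "indicator (l1_ball d c r) (\<lambda>i\<in>{..<d}. c i + r * u i) = (indicator {..1} (l1_norm d u) :: ennreal)"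
        using r by (auto simp: l1_ball_def Rd_def split: split_indicator)
    qed
    finally show ?thesis .
  qed
  have "emeasure (lebesgue_Rd d) (l1_ball d c r) = (\<integral>\<^sup>+y\<in>l1_ball d c r. 1 \<partial>lebesgue_Rd d)"
    by simp
  also have "\<dots> = ennreal (r ^ d) * ennreal (2 ^ d / fact d)"
    using ball[of "\<lambda>_. 1"] l1_ball_unit_volume[OF d] by simp
  finally have vol: "emeasure (lebesgue_Rd d) (l1_ball d c r) = ennreal (2 ^ d / fact d) * ennreal (r ^ d)"
    by (simp add: mult.commute)
  show ?thesis
    unfolding ball[OF g] vol mult.commute[of "ennreal (r ^ d)"]
    using r by (intro divide_mult_eq) auto
qed

section \<open>Bounds for the operator norm\<close>

text \<open>The modulus forces continuity, but the measure lives on extensional functions. So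
  \<open>f\<close> is first extended to all functions on \<open>nat\<close> by restricting the
  argument, where continuity in the product topology gives Borel measurability, and then pulled
  back.\<close>

lemma Lipschitz_imp_measurable:
  fixes f :: "(nat \<Rightarrow> real) \<Rightarrow> real"
  assumes \<omega>: "modulus_of_continuity \<omega>"
    and f: "\<And>x y. x \<in> Rd d \<Longrightarrow> y \<in> Rd d \<Longrightarrow> \<bar>f x - f y\<bar> \<le> K * \<omega> (l1_norm d (\<lambda>i. x i - y i))"
  shows "f \<in> borel_measurable (lebesgue_Rd d)"
proof -
  define F where "F x = f (restrict x {..<d})" for x
  have cont: "isCont F x" for x
    unfolding isCont_def
  proof (rule LIM_zero_cancel, rule Lim_null_comparison)
    have "continuous_on UNIV (\<lambda>y :: nat \<Rightarrow> real. y i)" for i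
      by (rule continuous_on_product_coordinates)
    then have coord: "(\<lambda>y :: nat \<Rightarrow> real. y i) \<midarrow>x\<rightarrow> x i" for i
      by (simp add: continuous_on_def)
    have "(\<lambda>y. l1_norm d (\<lambda>i. y i - x i)) \<midarrow>x\<rightarrow> (\<Sum>i<d. \<bar>x i - x i\<bar>)"
      unfolding l1_norm_def by (intro tendsto_sum tendsto_rabs tendsto_diff tendsto_const coord)
    then have norm0: "(\<lambda>y. l1_norm d (\<lambda>i. y i - x i)) \<midarrow>x\<rightarrow> 0"
      by simp
    have "isCont (extend0 \<omega>) 0"
      using continuous_extend0[OF \<omega>] by (simp add: continuous_on_eq_continuous_at)
    from isCont_tendsto_compose[OF this norm0]
    have "(\<lambda>y. extend0 \<omega> (l1_norm d (\<lambda>i. y i - x i))) \<midarrow>x\<rightarrow> 0"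
      by (simp only: extend0_eq order_refl modulus_0[OF \<omega>])
    then show "(\<lambda>y. K * extend0 \<omega> (l1_norm d (\<lambda>i. y i - x i))) \<midarrow>x\<rightarrow> 0"
      by (rule tendsto_mult_right_zero)
    have "\<bar>F y - F x\<bar> \<le> K * extend0 \<omega> (l1_norm d (\<lambda>i. y i - x i))" for y
    proof -
      have "l1_norm d (\<lambda>i. restrict y {..<d} i - restrict x {..<d} i) = l1_norm d (\<lambda>i. y i - x i)"
        by (simp add: l1_norm_def)
      then show ?thesis
        using f[of "restrict y {..<d}" "restrict x {..<d}"] by (simp add: F_def Rd_def)
    qed
    then show "\<forall>\<^sub>F y in at x. norm (F y - F x) \<le> K * extend0 \<omega> (l1_norm d (\<lambda>i. y i - x i))"
      by (intro always_eventually allI) (simp only: real_norm_def)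
  qed
  then have F: "F \<in> borel_measurable borel"
    by (intro borel_measurable_continuous_onI) (simp add: continuous_at_imp_continuous_on)
  \<comment> \<open>The coordinates from \<open>d\<close> on are filled with 0 to land in the full
    function space; \<open>F\<close> restricts its argument and does not see them.\<close>
  have "(\<lambda>x i. if i < d then x i else 0) \<in> lebesgue_Rd d \<rightarrow>\<^sub>M Pi\<^sub>M UNIV (\<lambda>_. borel :: real measure)"
  proof (rule measurable_PiM_single')
    show "(\<lambda>x. if i < d then x i else 0) \<in> borel_measurable (lebesgue_Rd d)" for i
      by (cases "i < d") (auto intro: component_measurable_lebesgue_Rd)
  qed auto
  then have "(\<lambda>x i. if i < d then x i else 0) \<in> lebesgue_Rd d \<rightarrow>\<^sub>M borel"
    unfolding measurable_cong_sets[OF refl sets_PiM_equal_borel] .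
  from measurable_compose[OF this F]
  have "(\<lambda>x. F (\<lambda>i. if i < d then x i else 0)) \<in> borel_measurable (lebesgue_Rd d)" .
  moreover have "F (\<lambda>i. if i < d then x i else 0) = f x" if "x \<in> space (lebesgue_Rd d)" for x
  proof -
    have "restrict (\<lambda>i. if i < d then x i else 0) {..<d} = x"
    proof
      fix i
      show "restrict (\<lambda>i. if i < d then x i else 0) {..<d} i = x i"
        using that PiE_arb[of x "{..<d}" "\<lambda>_. UNIV" i] by (cases "i < d") (auto simp: space_lebesgue_Rd Rd_def)
    qed
    then show ?thesis
      by (simp only: F_def)
  qed
  ultimately show ?thesis
    by (subst (asm) measurable_cong[where g=f]) auto
qed

text \<open>
  The affine map from the ball \<open>B\<close> around \<open>c\<close> of radius \<open>r\<close> onto the ball around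
  \<open>c + (1 - R) (y - x)\<close> of radius \<open>r + t R\<close>, where \<open>t\<close> is the distance of \<open>x\<close> and \<open>y\<close>,
  moves the point with relative position \<open>u\<close> by \<open>(1 - R) (y - x) + t R u\<close>, regardless of
  \<open>r\<close>; and the larger ball contains \<open>y\<close> when \<open>B\<close> contains \<open>x\<close>.
\<close>

lemma ball_average_transport:
  assumes \<omega>: "modulus_of_continuity \<omega>" and d: "2 \<le> d" and K: "0 \<le> K"
    and f: "\<And>x y. x \<in> Rd d \<Longrightarrow> y \<in> Rd d \<Longrightarrow> \<bar>f x - f y\<bar> \<le> K * \<omega> (l1_norm d (\<lambda>i. x i - y i))"
    and xy: "y \<in> Rd d" "x \<in> l1_ball d c r" and r: "0 < r" and R: "0 < R" "R \<le> 1"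
    and t: "t = l1_norm d (\<lambda>i. x i - y i)" "0 < t"
  shows "(\<integral>\<^sup>+z\<in>l1_ball d c r. ennreal \<bar>f z\<bar> \<partial>lebesgue_Rd d) / emeasure (lebesgue_Rd d) (l1_ball d c r)
    \<le> maximal_fun d f y + ennreal (K * radial_average \<omega> d t R)"
proof -
  note [measurable] = extend0_measurable[OF \<omega>] Lipschitz_imp_measurable[OF \<omega> f]
  define v where "v = (\<lambda>i. (1 - R) * (y i - x i))"
  define c' where "c' = (\<lambda>i\<in>{..<d}. c i + v i)"
  define r' where "r' = r + t * R"
  have r': "0 < r'" using r R t by (simp add: r'_def add_pos_pos)
  let ?V = "ennreal (2 ^ d / fact d)" and ?T = "\<lambda>u. \<lambda>i\<in>{..<d}. c i + r * u i"
    and ?T' = "\<lambda>u. \<lambda>i\<in>{..<d}. c' i + r' * u i"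
  have T [measurable]: "?T \<in> lebesgue_Rd d \<rightarrow>\<^sub>M lebesgue_Rd d" "?T' \<in> lebesgue_Rd d \<rightarrow>\<^sub>M lebesgue_Rd d"
    unfolding lebesgue_Rd_def by measurable
  have shift: "l1_norm d (\<lambda>i. ?T u i - ?T' u i) = l1_norm d (\<lambda>i. v i + t * R * u i)" for u
  proof -
    have "\<bar>?T u i - ?T' u i\<bar> = \<bar>v i + t * R * u i\<bar>" if "i < d" for i
      using that by (simp add: c'_def r'_def algebra_simps)
    then show ?thesis by (simp add: l1_norm_def)
  qed
  have "\<bar>f (?T u)\<bar> \<le> \<bar>f (?T' u)\<bar> + K * extend0 \<omega> (l1_norm d (\<lambda>i. v i + t * R * u i))" for u
    using f[of "?T u" "?T' u"] unfolding shift extend0_eq[OF l1_norm_nonneg]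
    by (simp add: Rd_def)
  then have "ennreal \<bar>f (?T u)\<bar> \<le>
      ennreal (\<bar>f (?T' u)\<bar> + K * extend0 \<omega> (l1_norm d (\<lambda>i. v i + t * R * u i)))" for u
    by (rule ennreal_leI)
  then have pointwise: "ennreal \<bar>f (?T u)\<bar> \<le>
      ennreal \<bar>f (?T' u)\<bar> + ennreal K * ennreal (extend0 \<omega> (l1_norm d (\<lambda>i. v i + t * R * u i)))" for u
    using ennreal_plus[OF abs_ge_zero mult_nonneg_nonneg[OF K extend0_nonneg[OF \<omega>]]]
    unfolding ennreal_mult'[OF K] by metis
  \<comment> \<open>The direction of \<open>y - x\<close> enters only through \<open>v\<close>.
    Replacing \<open>v\<close> by the axis vector of the same norm leaves a bound that depends on
    \<open>t\<close> and \<open>R\<close> alone.\<close>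
  have "ball_int d (\<lambda>s. ennreal (extend0 \<omega> s)) v (t * R)
      \<le> ball_int d (\<lambda>s. ennreal (extend0 \<omega> s)) (on_axis (l1_norm d v)) (t * R)"
    using d t R mono_extend0[OF \<omega>]
    by (intro ball_int_le_axis) (auto simp: mono_def intro: ennreal_leI)
  also have "l1_norm d v = t * (1 - R)"
    using R unfolding v_def l1_norm_scale t(1) l1_norm_minus_commute[of d x y] by simp
  finally have J: "ball_int d (\<lambda>s. ennreal (extend0 \<omega> s)) v (t * R)
      \<le> ball_int d (\<lambda>s. ennreal (extend0 \<omega> s)) (on_axis (t * (1 - R))) (t * R)" .
  have "(\<integral>\<^sup>+u. ennreal \<bar>f (?T u)\<bar> * indicator {..1} (l1_norm d u) \<partial>lebesgue_Rd d)
      \<le> (\<integral>\<^sup>+u. ennreal \<bar>f (?T' u)\<bar> * indicator {..1} (l1_norm d u) +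
        ennreal K * (ennreal (extend0 \<omega> (l1_norm d (\<lambda>i. v i + t * R * u i))) * indicator {..1} (l1_norm d u)) \<partial>lebesgue_Rd d)"
    using pointwise by (intro nn_integral_mono) (simp split: split_indicator)
  also have "\<dots> = (\<integral>\<^sup>+u. ennreal \<bar>f (?T' u)\<bar> * indicator {..1} (l1_norm d u) \<partial>lebesgue_Rd d) +
      ennreal K * ball_int d (\<lambda>s. ennreal (extend0 \<omega> s)) v (t * R)"
    unfolding ball_int_def by (subst nn_integral_add) (auto simp: nn_integral_cmult simp del: extend0_eq)
  also have "\<dots> \<le> (\<integral>\<^sup>+u. ennreal \<bar>f (?T' u)\<bar> * indicator {..1} (l1_norm d u) \<partial>lebesgue_Rd d) +
      ennreal K * ball_int d (\<lambda>s. ennreal (extend0 \<omega> s)) (on_axis (t * (1 - R))) (t * R)"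
    by (intro add_left_mono mult_left_mono J) simp
  finally have "(\<integral>\<^sup>+u. ennreal \<bar>f (?T u)\<bar> * indicator {..1} (l1_norm d u) \<partial>lebesgue_Rd d) / ?V \<le>
      ((\<integral>\<^sup>+u. ennreal \<bar>f (?T' u)\<bar> * indicator {..1} (l1_norm d u) \<partial>lebesgue_Rd d) +
        ennreal K * ball_int d (\<lambda>s. ennreal (extend0 \<omega> s)) (on_axis (t * (1 - R))) (t * R)) / ?V"
    by (rule divide_right_mono_ennreal)
  also have "\<dots> = (\<integral>\<^sup>+u. ennreal \<bar>f (?T' u)\<bar> * indicator {..1} (l1_norm d u) \<partial>lebesgue_Rd d) / ?V +
      ennreal K * ennreal (radial_average \<omega> d t R)"
    unfolding ball_int_axis_eq_radial_average[OF \<omega> d t(2) order.strict_implies_order[OF R(1)] R(2), symmetric]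
    by (simp add: divide_ennreal_def distrib_right mult.assoc)
  finally have "(\<integral>\<^sup>+z\<in>l1_ball d c r. ennreal \<bar>f z\<bar> \<partial>lebesgue_Rd d) / emeasure (lebesgue_Rd d) (l1_ball d c r)
      \<le> (\<integral>\<^sup>+z\<in>l1_ball d c' r'. ennreal \<bar>f z\<bar> \<partial>lebesgue_Rd d) / emeasure (lebesgue_Rd d) (l1_ball d c' r')
        + ennreal (K * radial_average \<omega> d t R)"
    using d r r' K by (subst (1 2) l1_ball_average) (auto simp: ennreal_mult')
  moreover have "y \<in> l1_ball d c' r'"
  proof -
    \<comment> \<open>The center has covered the part \<open>(1 - R) (y - x)\<close> of the way; the
      remaining \<open>R (y - x)\<close> has norm \<open>t R\<close>, exactly the amount by which
      the radius has grown.\<close>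
    have "l1_norm d (\<lambda>i. y i - c' i) = l1_norm d (\<lambda>i. (x i - c i) + R * (y i - x i))"
      unfolding l1_norm_def by (intro sum.cong) (auto simp: c'_def v_def algebra_simps)
    also have "\<dots> \<le> l1_norm d (\<lambda>i. x i - c i) + l1_norm d (\<lambda>i. R * (y i - x i))"
      by (rule l1_norm_triangle)
    also have "\<dots> \<le> r + R * t"
      using xy R unfolding l1_norm_scale t(1) l1_norm_minus_commute[of d x y] by (simp add: l1_ball_def)
    finally show ?thesis using xy by (simp add: l1_ball_def r'_def mult.commute)
  qed
  moreover have "c' \<in> Rd d" by (simp add: c'_def Rd_def)
  ultimately show ?thesis
    unfolding maximal_fun_def[of d f y] using r'
    by (elim order.trans) (intro add_right_mono SUP_upper, blast)
qed

lemma maximal_fun_le: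
  assumes "modulus_of_continuity \<omega>" "2 \<le> d" "0 \<le> K"
    and "\<And>x y. x \<in> Rd d \<Longrightarrow> y \<in> Rd d \<Longrightarrow> \<bar>f x - f y\<bar> \<le> K * \<omega> (l1_norm d (\<lambda>i. x i - y i))"
    and "y \<in> Rd d" "0 < R" "R \<le> 1"
    and "t = l1_norm d (\<lambda>i. x i - y i)" "0 < t"
  shows "maximal_fun d f x \<le> maximal_fun d f y + ennreal (K * radial_average \<omega> d t R)"
  unfolding maximal_fun_def[of d f x]
  by (intro SUP_least) (auto intro!: ball_average_transport assms)

section \<open>Balls of least average among those containing a point of the axis\<close>

text \<open>The range \<open>1/2 \<le> R \<le> 1\<close> comes from here. A ball containing
  \<open>t e_1\<close> has first center coordinate at least \<open>t - r\<close>, so for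
  \<open>t/2 \<le> r \<le> t\<close> shrinking the center coordinates gives the ball with
  \<open>R = r / t\<close>. A ball with \<open>r \<ge> t\<close> is centered at the origin and
  shrunk to radius \<open>t\<close>. A ball with \<open>r < t/2\<close> is enlarged from the fixed
  point \<open>t e_1\<close>, which lowers the norm pointwise until the ball reaches the origin at
  \<open>r = t/2\<close>.\<close>

lemma ball_int_lower_comparison:
  assumes \<phi>: "mono \<phi>" "\<phi> \<in> borel_measurable borel" and d: "0 < d" and t: "0 < t" and r: "0 < r"
    and c: "l1_norm d (\<lambda>i. on_axis t i - c i) \<le> r"
  shows "\<exists>R\<in>{1/2..1}. ball_int d \<phi> (on_axis (t * (1 - R))) (t * R) \<le> ball_int d \<phi> c r"
proof -
  have pointwise: "ball_int d \<phi> (on_axis a) b \<le> ball_int d \<phi> (on_axis a') b'"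
    if "0 \<le> b" "0 \<le> b'" "\<And>u s. 0 \<le> s \<Longrightarrow> \<bar>u\<bar> + s \<le> 1 \<Longrightarrow> \<bar>a + b * u\<bar> + b * s \<le> \<bar>a' + b' * u\<bar> + b' * s"
    for a b a' b'
    unfolding ball_int_def l1_norm_axis_affine[OF d that(1)] l1_norm_axis_affine[OF d that(2)]
    using that(3) d
    by (intro nn_integral_mono)
      (auto simp: l1_norm_split sum_nonneg intro!: monoD[OF \<phi>(1)] split: split_indicator)
  have c0: "t - r \<le> c 0"
    using c d by (simp add: l1_norm_split) (smt (verit) sum_nonneg abs_ge_zero)
  consider "t \<le> r" | "t / 2 \<le> r" "r \<le> t" | "r < t / 2" by linarith
  then show ?thesis
  proof cases
    case 1
    have "ball_int d \<phi> (on_axis 0) t \<le> ball_int d \<phi> (on_axis 0) r"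
    proof (rule pointwise)
      fix u s :: real assume "0 \<le> s"
      then have "t * (\<bar>u\<bar> + s) \<le> r * (\<bar>u\<bar> + s)" using 1 by (intro mult_right_mono) auto
      then show "\<bar>0 + t * u\<bar> + t * s \<le> \<bar>0 + r * u\<bar> + r * s"
        using t r by (simp add: abs_mult distrib_left)
    qed (use t r in auto)
    also have "\<dots> \<le> ball_int d \<phi> c r"
      by (intro ball_int_mono_abs \<phi> r) auto
    finally show ?thesis
      by (intro bexI[of _ 1]) (simp_all only: diff_self mult_zero_right mult_1_right, simp)
  next
    case 2
    have "ball_int d \<phi> (on_axis (t - r)) r \<le> ball_int d \<phi> c r"
      using c0 2 by (intro ball_int_mono_abs \<phi> r) auto
    moreover have "t * (1 - r / t) = t - r" "t * (r / t) = r" using t by (simp_all add: field_simps)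
    ultimately show ?thesis
      using 2 t by (intro bexI[of _ "r / t"]) (simp_all only:, simp add: field_simps)
  next
    case 3
    have "ball_int d \<phi> (on_axis (t / 2)) (t / 2) \<le> ball_int d \<phi> (on_axis (t - r)) r"
    proof (rule pointwise)
      fix u s :: real assume us: "0 \<le> s" "\<bar>u\<bar> + s \<le> 1"
      \<comment> \<open>The left side of the goal equals \<open>t - t/2 * (1 - u - s)\<close> and
        the right side is at least \<open>t - r * (1 - u - s)\<close>.\<close>
      have "r * (1 - u - s) \<le> t / 2 * (1 - u - s)" using us 3 by (intro mult_right_mono) auto
      moreover have "\<bar>t / 2 + t / 2 * u\<bar> = t / 2 + t / 2 * u"
      proof -
        have "0 \<le> t / 2 * (1 + u)" using us t by (intro mult_nonneg_nonneg) auto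
        then show ?thesis by (simp add: algebra_simps)
      qed
      ultimately show "\<bar>t / 2 + t / 2 * u\<bar> + t / 2 * s \<le> \<bar>t - r + r * u\<bar> + r * s"
        by (simp add: algebra_simps)
    qed (use t r in auto)
    also have "ball_int d \<phi> (on_axis (t - r)) r \<le> ball_int d \<phi> c r"
      using c0 3 t r by (intro ball_int_mono_abs \<phi> r) auto
    finally have "ball_int d \<phi> (on_axis (t / 2)) (t / 2) \<le> ball_int d \<phi> c r" .
    moreover have "t * (1 - 1 / 2) = t / 2" "t * (1 / 2) = t / 2" by simp_all
    ultimately show ?thesis by (intro bexI[of _ "1/2"]) (simp_all only:, simp)
  qed
qed

lemma radial_average_nonneg:
  assumes \<omega>: "modulus_of_continuity \<omega>" and "2 \<le> d" "0 < t" "0 \<le> R"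
  shows "0 \<le> radial_average \<omega> d t R"
proof -
  have "0 \<le> \<omega> (t * (\<bar>(1 - R) + R * u\<bar> + R * \<rho>)) * \<rho> ^ (d - 2)" if "0 \<le> \<rho>" for u \<rho>
    using that assms by (intro mult_nonneg_nonneg modulus_nonneg[OF \<omega>]) auto
  then have "0 \<le> (LBINT \<rho>:{0..1 - \<bar>u\<bar>}. \<omega> (t * (\<bar>(1 - R) + R * u\<bar> + R * \<rho>)) * \<rho> ^ (d - 2))" for u
    unfolding set_lebesgue_integral_def
    by (intro Bochner_Integration.integral_nonneg) (auto split: split_indicator)
  then have "0 \<le> (LBINT u:{-1..1}. LBINT \<rho>:{0..1 - \<bar>u\<bar>}. \<omega> (t * (\<bar>(1 - R) + R * u\<bar> + R * \<rho>)) * \<rho> ^ (d - 2))"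
    unfolding set_lebesgue_integral_def[of _ "{-1..1}"]
    by (intro Bochner_Integration.integral_nonneg) (auto split: split_indicator)
  then show ?thesis using assms by (simp add: radial_average_def)
qed

lemma nn_integral_unit_ball_le:
  assumes "0 < d" "\<And>u. l1_norm d u \<le> 1 \<Longrightarrow> g u \<le> M"
  shows "(\<integral>\<^sup>+u. g u * indicator {..1} (l1_norm d u) \<partial>lebesgue_Rd d) \<le> M * ennreal (2 ^ d / fact d)"
proof -
  have "(\<integral>\<^sup>+u. g u * indicator {..1} (l1_norm d u) \<partial>lebesgue_Rd d)
      \<le> (\<integral>\<^sup>+u. M * indicator {..1} (l1_norm d u) \<partial>lebesgue_Rd d)"
    using assms(2) by (intro nn_integral_mono) (auto split: split_indicator)
  also have "\<dots> = M * (\<integral>\<^sup>+u. indicator {..1} (l1_norm d u) \<partial>lebesgue_Rd d)"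
    by (intro nn_integral_cmult) measurable
  finally show ?thesis by (simp add: l1_ball_unit_volume assms(1))
qed

lemma unit_volume_pos: "ennreal (2 ^ d / fact d) \<noteq> 0" "ennreal (2 ^ d / fact d) \<noteq> top"
  by auto

lemma axis_norm_scaled_le:
  assumes "0 < d" "0 < t" "0 \<le> R" "R \<le> 1" "l1_norm d u \<le> 1"
  shows "l1_norm d (\<lambda>i. on_axis (t * (1 - R)) i + t * R * u i) \<le> t"
proof -
  let ?s = "\<Sum>i=1..<d. \<bar>u i\<bar>"
  have "l1_norm d (\<lambda>i. on_axis (t * (1 - R)) i + t * R * u i) = \<bar>t * (1 - R) + t * R * u 0\<bar> + t * R * ?s"
    using assms by (intro l1_norm_axis_affine) auto
  also have "\<dots> = t * (\<bar>(1 - R) + R * u 0\<bar> + R * ?s)"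
    using assms by (intro axis_norm_scale) auto
  also have "\<dots> \<le> t * 1"
    using assms by (intro mult_left_mono axis_norm_le) (auto simp: l1_norm_split sum_nonneg)
  finally show ?thesis by simp
qed

text \<open>The ball with center \<open>t (1 - R) e_1\<close> and radius \<open>t R\<close> lies in
  the ball of radius \<open>t\<close> around the origin.\<close>

lemma radial_average_le:
  assumes \<omega>: "modulus_of_continuity \<omega>" and d: "2 \<le> d" and t: "0 < t" and R: "0 \<le> R" "R \<le> 1"
  shows "radial_average \<omega> d t R \<le> \<omega> t"
proof -
  have "ball_int d (\<lambda>s. ennreal (extend0 \<omega> s)) (on_axis (t * (1 - R))) (t * R)
      \<le> ennreal (extend0 \<omega> t) * ennreal (2 ^ d / fact d)"
    unfolding ball_int_def
    using d t R
    by (intro nn_integral_unit_ball_le ennreal_leI monoD[OF mono_extend0[OF \<omega>]] axis_norm_scaled_le) auto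
  then have "ennreal (radial_average \<omega> d t R)
      \<le> ennreal (extend0 \<omega> t) * ennreal (2 ^ d / fact d) / ennreal (2 ^ d / fact d)"
    unfolding ball_int_axis_eq_radial_average[OF assms, symmetric]
    by (rule divide_right_mono_ennreal)
  also have "\<dots> = ennreal (extend0 \<omega> t)"
    by (rule mult_divide_eq_ennreal[OF unit_volume_pos])
  finally show ?thesis
    using t extend0_nonneg[OF \<omega>, of t] by (simp add: ennreal_le_iff)
qed

section \<open>The sup-inf expression and the two inequalities\<close>

definition sup_inf_radial :: "(real \<Rightarrow> real) \<Rightarrow> nat \<Rightarrow> ereal" where
  "sup_inf_radial \<omega> d = (SUP t\<in>{0<..}. INF R\<in>{1/2..1}. ereal (radial_average \<omega> d t R / \<omega> t))"

lemma sup_inf_radial_nonneg: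
  assumes "modulus_of_continuity \<omega>" "2 \<le> d"
  shows "0 \<le> sup_inf_radial \<omega> d"
proof -
  have "0 \<le> (INF R\<in>{1/2..1}. ereal (radial_average \<omega> d 1 R / \<omega> 1))"
    using assms modulus_nonneg[of \<omega> 1]
    by (intro INF_greatest) (auto intro!: divide_nonneg_nonneg radial_average_nonneg)
  also have "\<dots> \<le> sup_inf_radial \<omega> d"
    unfolding sup_inf_radial_def by (intro SUP_upper2[of 1]) auto
  finally show ?thesis .
qed

lemma sup_inf_radial_le_1:
  assumes \<omega>: "modulus_of_continuity \<omega>" and d: "2 \<le> d"
  shows "sup_inf_radial \<omega> d \<le> 1"
  unfolding sup_inf_radial_def
proof (intro SUP_least)
  fix t :: real assume "t \<in> {0<..}"
  then have "radial_average \<omega> d t 1 / \<omega> t \<le> 1"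
    using radial_average_le[OF \<omega> d, of t 1] modulus_pos[OF \<omega>, of t] by simp
  then show "(INF R\<in>{1/2..1}. ereal (radial_average \<omega> d t R / \<omega> t)) \<le> 1"
    by (intro INF_lower2[of 1]) auto
qed

lemma l1_norm_eq_0_iff:
  assumes "x \<in> Rd d" "y \<in> Rd d"
  shows "l1_norm d (\<lambda>i. x i - y i) = 0 \<longleftrightarrow> x = y"
proof
  assume "l1_norm d (\<lambda>i. x i - y i) = 0"
  then have "x i = y i" if "i < d" for i
    using that by (simp add: l1_norm_def sum_nonneg_eq_0_iff)
  then show "x = y"
    using assms by (intro PiE_ext[of x "{..<d}" _ y]) (auto simp: Rd_def)
qed (simp add: l1_norm_def)

lemma l1_norm_pos: "x \<in> Rd d \<Longrightarrow> y \<in> Rd d \<Longrightarrow> x \<noteq> y \<Longrightarrow> 0 < l1_norm d (\<lambda>i. x i - y i)"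
  using l1_norm_eq_0_iff[of x d y] l1_norm_nonneg[of d "\<lambda>i. x i - y i"] by linarith

text \<open>The point \<open>z\<close> rules out the convention that an identically infinite
  function has norm 0; otherwise the bound could fail.\<close>

lemma lip_norm_upper:
  assumes "x \<in> Rd d" "y \<in> Rd d" "x \<noteq> y" "z \<in> Rd d" "g z \<noteq> \<infinity>"
  shows "\<bar>g x - g y\<bar> / ereal (\<omega> (l1_norm d (\<lambda>i. x i - y i))) \<le> lip_norm d \<omega> g"
proof -
  have "\<not> (\<forall>x\<in>Rd d. g x = \<infinity>)" using assms by blast
  then show ?thesis
    unfolding lip_norm_def using assms
    by (simp only: if_False) (intro SUP_upper2[of "(x, y)"], auto)
qed

lemma lip_norm_least:
  assumes "0 \<le> C"
    and "\<And>x y. x \<in> Rd d \<Longrightarrow> y \<in> Rd d \<Longrightarrow> x \<noteq> y \<Longrightarrow>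
      \<bar>g x - g y\<bar> / ereal (\<omega> (l1_norm d (\<lambda>i. x i - y i))) \<le> C"
  shows "lip_norm d \<omega> g \<le> C"
  unfolding lip_norm_def using assms by (auto intro!: SUP_least)

lemma maximal_op_norm_le:
  assumes \<omega>: "modulus_of_continuity \<omega>" and d: "2 \<le> d"
  shows "maximal_op_norm d \<omega> \<le> sup_inf_radial \<omega> d"
  unfolding maximal_op_norm_def
proof (rule SUP_least)
  let ?S = "sup_inf_radial \<omega> d"
  fix f assume f: "f \<in> {f \<in> Lip d \<omega>. lip_norm d \<omega> (\<lambda>x. ereal (f x)) \<noteq> 0}"
  define K where "K = lip_norm d \<omega> (\<lambda>x. ereal (f x))"
  \<comment> \<open>Two distinct points make the supremum defining \<open>K\<close> one over a
    nonempty set, which yields \<open>0 \<le> K\<close> and hence a positive real constant.\<close>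
  define z0 where "z0 = (\<lambda>i\<in>{..<d}. 0 :: real)"
  define z1 where "z1 = (\<lambda>i\<in>{..<d}. 1 :: real)"
  have z01: "z0 \<in> Rd d" "z1 \<in> Rd d" by (auto simp: z0_def z1_def Rd_def)
  have "z0 0 \<noteq> z1 0" using d by (simp add: z0_def z1_def)
  then have "z0 \<noteq> z1" by auto
  have quot: "ereal (\<bar>f x - f y\<bar> / \<omega> (l1_norm d (\<lambda>i. x i - y i))) \<le> K"
    if "x \<in> Rd d" "y \<in> Rd d" "x \<noteq> y" for x y
    using lip_norm_upper[OF that z01(1), of "\<lambda>x. ereal (f x)" \<omega>]
      modulus_pos[OF \<omega> l1_norm_pos[OF that]] by (simp add: K_def)
  have "0 \<le> ereal (\<bar>f z0 - f z1\<bar> / \<omega> (l1_norm d (\<lambda>i. z0 i - z1 i)))"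
    using modulus_nonneg[OF \<omega> l1_norm_nonneg] by simp
  also have "\<dots> \<le> K" by (rule quot[OF z01 \<open>z0 \<noteq> z1\<close>])
  finally have "0 \<le> K" .
  moreover have "K \<noteq> 0" "K < \<infinity>" using f by (auto simp: K_def Lip_def)
  ultimately obtain k where k: "K = ereal k" "0 < k"
    by (cases K) (auto simp: less_le)
  have lip: "\<bar>f x - f y\<bar> \<le> k * \<omega> (l1_norm d (\<lambda>i. x i - y i))" if "x \<in> Rd d" "y \<in> Rd d" for x y
  proof (cases "x = y")
    case True
    then show ?thesis using k modulus_nonneg[OF \<omega> l1_norm_nonneg] by simp
  next
    case False
    from quot[OF that this] show ?thesis
      using modulus_pos[OF \<omega> l1_norm_pos[OF that False]] by (simp add: k pos_divide_le_eq)
  qed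
  have key: "maximal_fun d f x \<le> maximal_fun d f y + ennreal (k * radial_average \<omega> d (l1_norm d (\<lambda>i. x i - y i)) R)"
    if "x \<in> Rd d" "y \<in> Rd d" "x \<noteq> y" "R \<in> {1/2..1}" for x y R
    using that l1_norm_pos[OF that(1-3)] k by (intro maximal_fun_le[OF \<omega> d _ lip]) auto
  let ?g = "\<lambda>x. enn2ereal (maximal_fun d f x)"
  have "lip_norm d \<omega> ?g \<le> K * ?S"
  proof (cases "\<forall>x\<in>Rd d. ?g x = \<infinity>")
    case True
    then show ?thesis
      using k sup_inf_radial_nonneg[OF \<omega> d] by (simp add: lip_norm_def)
  next
    case False
    then obtain z where z: "z \<in> Rd d" "maximal_fun d f z \<noteq> top"
      by (metis infinity_ereal_def enn2ereal_top top_ereal_def)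
    \<comment> \<open>Finiteness spreads from one point to all: for two points the comparison
      \<open>key\<close> has a finite error term.\<close>
    have fin: "maximal_fun d f x \<noteq> top" if "x \<in> Rd d" for x
    proof (cases "x = z")
      case False
      from key[OF that z(1) this, of 1] z(2) show ?thesis
        by (auto simp: top_unique)
    qed (use z in simp)
    show ?thesis
    proof (rule lip_norm_least)
      show "0 \<le> K * ?S"
        using k sup_inf_radial_nonneg[OF \<omega> d] by simp
      fix x y assume xy: "x \<in> Rd d" "y \<in> Rd d" "x \<noteq> y"
      define t where "t = l1_norm d (\<lambda>i. x i - y i)"
      have t: "0 < t" unfolding t_def by (rule l1_norm_pos[OF xy])
      have \<omega>t: "0 < \<omega> t" by (rule modulus_pos[OF \<omega> t])
      obtain a where a: "maximal_fun d f x = ennreal a" "0 \<le> a"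
        using fin[OF xy(1)] by (cases "maximal_fun d f x") auto
      obtain b where b: "maximal_fun d f y = ennreal b" "0 \<le> b"
        using fin[OF xy(2)] by (cases "maximal_fun d f y") auto
      have "ereal (\<bar>a - b\<bar> / \<omega> t / k) \<le> (INF R\<in>{1/2..1}. ereal (radial_average \<omega> d t R / \<omega> t))"
      proof (rule INF_greatest)
        fix R :: real assume R: "R \<in> {1/2..1}"
        have nn: "0 \<le> k * radial_average \<omega> d t R"
          using k R t by (intro mult_nonneg_nonneg radial_average_nonneg[OF \<omega> d]) auto
        have "a \<le> b + k * radial_average \<omega> d t R"
          using key[OF xy R] a b nn by (simp add: t_def[symmetric] flip: ennreal_plus)
        moreover have "b \<le> a + k * radial_average \<omega> d t R"
          using key[OF xy(2,1) xy(3)[symmetric] R] a b nn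
          by (simp add: t_def[symmetric] l1_norm_minus_commute[of d y x] flip: ennreal_plus)
        ultimately have "\<bar>a - b\<bar> \<le> k * radial_average \<omega> d t R" by linarith
        then show "ereal (\<bar>a - b\<bar> / \<omega> t / k) \<le> ereal (radial_average \<omega> d t R / \<omega> t)"
          using \<omega>t k by (simp add: field_simps)
      qed
      also have "\<dots> \<le> ?S"
        unfolding sup_inf_radial_def using t by (intro SUP_upper) auto
      finally have "K * ereal (\<bar>a - b\<bar> / \<omega> t / k) \<le> K * ?S"
        using k by (intro ereal_mult_left_mono) auto
      moreover have "\<bar>?g x - ?g y\<bar> / ereal (\<omega> t) = K * ereal (\<bar>a - b\<bar> / \<omega> t / k)"
        using a b k \<omega>t by simp
      ultimately show "\<bar>?g x - ?g y\<bar> / ereal (\<omega> (l1_norm d (\<lambda>i. x i - y i))) \<le> K * ?S"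
        by (simp only: t_def)
    qed
  qed
  then show "lip_norm d \<omega> ?g / lip_norm d \<omega> (\<lambda>x. ereal (f x)) \<le> ?S"
    unfolding K_def[symmetric] using k by (simp add: ereal_divide_le_pos)
qed

text \<open>Truncating at \<open>\<omega> t\<close> keeps the test function \<open>f\<close>
  nonnegative, so \<open>\<bar>f\<bar> = f\<close> and its average over any ball is
  \<open>\<omega> t\<close> minus the average of \<open>h\<close>. At the origin \<open>Mf\<close>
  equals the peak value \<open>\<omega> t\<close>; at \<open>t e_1\<close> it is smaller by at least
  the least average of \<open>h\<close>. Since \<open>f\<close> has norm 1, this drop divided by
  \<open>\<omega> t\<close> bounds the operator norm from below.\<close>

lemma maximal_op_norm_ge:
  assumes \<omega>: "modulus_of_continuity \<omega>" and d: "2 \<le> d" and t: "0 < t"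
  shows "(INF R\<in>{1/2..1}. ereal (radial_average \<omega> d t R / \<omega> t)) \<le> maximal_op_norm d \<omega>"
proof -
  note [measurable] = extend0_measurable[OF \<omega>]
  have d0: "0 < d" using d by simp
  have \<omega>t: "0 < \<omega> t" by (rule modulus_pos[OF \<omega> t])
  let ?I = "INF R\<in>{1/2..1}. ereal (radial_average \<omega> d t R / \<omega> t)"
  have rad: "0 \<le> radial_average \<omega> d t R \<and> radial_average \<omega> d t R \<le> \<omega> t" if "R \<in> {1/2..1}" for R
    using that t by (intro conjI radial_average_nonneg[OF \<omega> d] radial_average_le[OF \<omega> d]) auto
  have "0 \<le> ?I" "?I \<le> ereal (radial_average \<omega> d t 1 / \<omega> t)"
    using rad \<omega>t by (auto intro!: INF_greatest INF_lower)
  then obtain m where m: "?I = ereal m" "0 \<le> m"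
    by (cases ?I) auto
  \<comment> \<open>The infimum over \<open>R\<close> of the radial averages at scale
    \<open>t\<close>, before division by \<open>\<omega> t\<close>.\<close>
  define q where "q = m * \<omega> t"
  have q_le: "q \<le> radial_average \<omega> d t R" if "R \<in> {1/2..1}" for R
  proof -
    have "ereal m \<le> ereal (radial_average \<omega> d t R / \<omega> t)"
      unfolding m(1)[symmetric] using that by (rule INF_lower)
    then show ?thesis using \<omega>t by (simp add: q_def pos_le_divide_eq)
  qed
  have q: "0 \<le> q" "q \<le> \<omega> t"
    using m \<omega>t order_trans[OF q_le[of 1], of "\<omega> t"] rad[of 1] by (simp_all add: q_def)
  define h where "h s = min (extend0 \<omega> s) (\<omega> t)" for s
  have h_mono: "mono h"
    using monoD[OF mono_extend0[OF \<omega>]] by (auto simp: h_def mono_def min_le_iff_disj)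
  have h_meas [measurable]: "h \<in> borel_measurable borel"
    unfolding h_def by measurable
  have h0: "0 \<le> h s" "h s \<le> \<omega> t" for s
    using extend0_nonneg[OF \<omega>] \<omega>t by (auto simp: h_def)
  define f where "f z = \<omega> t - h (l1_norm d z)" for z
  have f0: "0 \<le> f z" "f z \<le> \<omega> t" for z
    using h0 by (auto simp: f_def)
  have f_lip: "\<bar>f x - f y\<bar> \<le> 1 * \<omega> (l1_norm d (\<lambda>i. x i - y i))" for x y
  proof -
    have "\<bar>f x - f y\<bar> \<le> \<bar>\<omega> (l1_norm d x) - \<omega> (l1_norm d y)\<bar>"
      unfolding f_def h_def extend0_eq[OF l1_norm_nonneg] by linarith
    also have "\<dots> \<le> \<omega> \<bar>l1_norm d x - l1_norm d y\<bar>"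
      by (intro modulus_abs_diff[OF \<omega>]) auto
    also have "\<dots> \<le> \<omega> (l1_norm d (\<lambda>i. x i - y i))"
    proof (intro modulus_mono[OF \<omega>])
      show "\<bar>l1_norm d x - l1_norm d y\<bar> \<le> l1_norm d (\<lambda>i. x i - y i)"
        using l1_norm_triangle[of d y "\<lambda>i. x i - y i"] l1_norm_triangle[of d x "\<lambda>i. y i - x i"]
        by (simp add: l1_norm_minus_commute[of d y x] abs_le_iff)
    qed simp
    finally show ?thesis by simp
  qed
  have f_meas [measurable]: "f \<in> borel_measurable (lebesgue_Rd d)"
    unfolding f_def by measurable
  let ?V = "ennreal (2 ^ d / fact d)"
  let ?A = "\<lambda>c r. \<integral>\<^sup>+u. ennreal \<bar>f (\<lambda>i\<in>{..<d}. c i + r * u i)\<bar> * indicator {..1} (l1_norm d u) \<partial>lebesgue_Rd d"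
  have f_T: "f (\<lambda>i\<in>{..<d}. c i + r * u i) = \<omega> t - h (l1_norm d (\<lambda>i. c i + r * u i))" for c r u
    by (simp add: f_def l1_norm_def)
  have average: "(\<integral>\<^sup>+z\<in>l1_ball d c r. ennreal \<bar>f z\<bar> \<partial>lebesgue_Rd d) / emeasure (lebesgue_Rd d) (l1_ball d c r)
      = ?A c r / ?V" if "0 < r" for c r
    using that d0 by (intro l1_ball_average) auto
  have Mf_le: "maximal_fun d f x \<le> ennreal (\<omega> t)" for x
    unfolding maximal_fun_def
  proof (rule SUP_least, clarify)
    fix c r assume "0 < (r::real)"
    have "?A c r / ?V \<le> ennreal (\<omega> t) * ?V / ?V"
      using f0 d0 by (intro divide_right_mono_ennreal nn_integral_unit_ball_le) (auto intro!: ennreal_leI)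
    then show "(\<integral>\<^sup>+z\<in>l1_ball d c r. ennreal \<bar>f z\<bar> \<partial>lebesgue_Rd d) / emeasure (lebesgue_Rd d) (l1_ball d c r)
        \<le> ennreal (\<omega> t)"
      unfolding average[OF \<open>0 < r\<close>] mult_divide_eq_ennreal[OF unit_volume_pos] .
  qed
  define z0 where "z0 = (\<lambda>i\<in>{..<d}. 0 :: real)"
  define z1 where "z1 = (\<lambda>i\<in>{..<d}. on_axis t i)"
  have z01: "z0 \<in> Rd d" "z1 \<in> Rd d" by (auto simp: z0_def z1_def Rd_def)
  have z01_diff: "l1_norm d (\<lambda>i. z0 i - z1 i) = t"
    using d0 t l1_norm_axis_affine[of d 0 t "\<lambda>_. 0"] by (simp add: l1_norm_def z0_def z1_def)
  then have "z0 \<noteq> z1"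
    using t l1_norm_eq_0_iff[OF z01] by auto
  \<comment> \<open>The peak need not be the average over any single ball. It is approached by balls
    of radius \<open>s\<close> around the origin, on which \<open>f\<close> is at least
    \<open>\<omega> t - \<omega> s\<close>.\<close>
  have Mf_z0: "ennreal (\<omega> t) \<le> maximal_fun d f z0"
  proof (rule ennreal_le_epsilon)
    fix e :: real assume "0 < e"
    then obtain s where s: "0 < s" "\<omega> s < e"
      using modulus_tendsto_0[OF \<omega>] by blast
    have "z0 \<in> l1_ball d z0 s"
      using s z01 by (simp add: l1_ball_def l1_norm_def)
    have "\<omega> t - \<omega> s \<le> f (\<lambda>i\<in>{..<d}. z0 i + s * u i)" if "l1_norm d u \<le> 1" for u
    proof -
      have "l1_norm d (\<lambda>i. z0 i + s * u i) = s * l1_norm d u"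
        using s by (simp add: l1_norm_def z0_def abs_mult sum_distrib_left)
      also have "\<dots> \<le> s * 1" using that s by (intro mult_left_mono) auto
      finally have "h (l1_norm d (\<lambda>i. z0 i + s * u i)) \<le> extend0 \<omega> s"
        using monoD[OF mono_extend0[OF \<omega>]] by (auto simp: h_def min_le_iff_disj simp del: extend0_eq)
      then show ?thesis unfolding f_T using s by simp
    qed
    then have "(\<integral>\<^sup>+u. ennreal (\<omega> t - \<omega> s) * indicator {..1} (l1_norm d u) \<partial>lebesgue_Rd d) \<le> ?A z0 s"
      using f0 by (intro nn_integral_mono) (auto split: split_indicator intro!: ennreal_leI)
    moreover have "(\<integral>\<^sup>+u. ennreal (\<omega> t - \<omega> s) * indicator {..1} (l1_norm d u) \<partial>lebesgue_Rd d)
        = ennreal (\<omega> t - \<omega> s) * ?V"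
      using l1_ball_unit_volume[OF d0] by (subst nn_integral_cmult) auto
    ultimately have "ennreal (\<omega> t - \<omega> s) * ?V / ?V \<le> ?A z0 s / ?V"
      by (intro divide_right_mono_ennreal) simp
    also have "\<dots> \<le> maximal_fun d f z0"
      unfolding average[OF s(1), symmetric] maximal_fun_def
      using z01 s \<open>z0 \<in> l1_ball d z0 s\<close> by (intro SUP_upper) blast
    finally have "ennreal (\<omega> t - \<omega> s) \<le> maximal_fun d f z0"
      unfolding mult_divide_eq_ennreal[OF unit_volume_pos] .
    moreover have "ennreal (\<omega> t) \<le> ennreal (\<omega> t - \<omega> s) + ennreal e"
    proof -
      \<comment> \<open>The maximum with 0 covers the case \<open>\<omega> s > \<omega> t\<close>,
        in which \<open>ennreal\<close> sends the negative difference to 0.\<close>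
      have "ennreal (\<omega> t) \<le> ennreal (max 0 (\<omega> t - \<omega> s) + e)"
        using s by (intro ennreal_leI) auto
      also have "\<dots> = ennreal (max 0 (\<omega> t - \<omega> s)) + ennreal e"
        using \<open>0 < e\<close> by (intro ennreal_plus) auto
      also have "ennreal (max 0 (\<omega> t - \<omega> s)) = ennreal (\<omega> t - \<omega> s)"
        by (simp add: max_def ennreal_neg)
      finally show ?thesis .
    qed
    ultimately show "ennreal (\<omega> t) \<le> maximal_fun d f z0 + ennreal e"
      by (meson add_right_mono order_trans)
  qed
  have Mf_z1: "maximal_fun d f z1 \<le> ennreal (\<omega> t - q)"
    unfolding maximal_fun_def
  proof (rule SUP_least, clarify)
    fix c r assume r: "0 < (r::real)" and "z1 \<in> l1_ball d c r"
    then have "l1_norm d (\<lambda>i. on_axis t i - c i) \<le> r"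
      by (simp add: l1_ball_def z1_def l1_norm_def)
    moreover have "mono (\<lambda>s. ennreal (h s))"
      using monoD[OF h_mono] by (auto intro!: monoI ennreal_leI)
    ultimately obtain R where R: "R \<in> {1/2..1}" and
      J: "ball_int d (\<lambda>s. ennreal (h s)) (on_axis (t * (1 - R))) (t * R) \<le> ball_int d (\<lambda>s. ennreal (h s)) c r"
      using ball_int_lower_comparison[of "\<lambda>s. ennreal (h s)" d t r c] d0 t r by auto
    \<comment> \<open>On this ball the norm is at most \<open>t\<close>, so the truncation in
      \<open>h\<close> has no effect there.\<close>
    have "ball_int d (\<lambda>s. ennreal (h s)) (on_axis (t * (1 - R))) (t * R)
        = ball_int d (\<lambda>s. ennreal (extend0 \<omega> s)) (on_axis (t * (1 - R))) (t * R)"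
      unfolding ball_int_def
    proof (intro nn_integral_cong)
      fix u
      show "ennreal (h (l1_norm d (\<lambda>i. on_axis (t * (1 - R)) i + t * R * u i))) * indicator {..1} (l1_norm d u)
        = ennreal (extend0 \<omega> (l1_norm d (\<lambda>i. on_axis (t * (1 - R)) i + t * R * u i))) * indicator {..1} (l1_norm d u)"
      proof (cases "l1_norm d u \<le> 1")
        case True
        have "l1_norm d (\<lambda>i. on_axis (t * (1 - R)) i + t * R * u i) \<le> t"
          using R t d0 True by (intro axis_norm_scaled_le) auto
        then have "h (l1_norm d (\<lambda>i. on_axis (t * (1 - R)) i + t * R * u i)) =
            extend0 \<omega> (l1_norm d (\<lambda>i. on_axis (t * (1 - R)) i + t * R * u i))"
          unfolding h_def using modulus_mono[OF \<omega> l1_norm_nonneg] by (simp add: min_absorb1)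
        then show ?thesis by (simp only:)
      qed simp
    qed
    also have "\<dots> / ?V = ennreal (radial_average \<omega> d t R)"
      using R t by (intro ball_int_axis_eq_radial_average[OF \<omega> d]) auto
    finally have "ennreal (radial_average \<omega> d t R) \<le> ball_int d (\<lambda>s. ennreal (h s)) c r / ?V"
      using divide_right_mono_ennreal[OF J, of ?V] by simp
    then have "ennreal q \<le> ball_int d (\<lambda>s. ennreal (h s)) c r / ?V"
      using q_le[OF R] by (meson ennreal_leI order_trans)
    \<comment> \<open>Subtraction in \<open>ennreal\<close> is avoided by adding: the averages of
      \<open>f\<close> and \<open>h\<close> sum to \<open>\<omega> t\<close>, and that of
      \<open>h\<close> is at least \<open>q\<close>.\<close>
    then have "?A c r / ?V + ennreal q \<le> ?A c r / ?V + ball_int d (\<lambda>s. ennreal (h s)) c r / ?V"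
      by (rule add_left_mono)
    also have "\<dots> = (?A c r + ball_int d (\<lambda>s. ennreal (h s)) c r) / ?V"
      by (simp add: divide_ennreal_def distrib_right)
    also have "?A c r + ball_int d (\<lambda>s. ennreal (h s)) c r
        = (\<integral>\<^sup>+u. ennreal \<bar>f (\<lambda>i\<in>{..<d}. c i + r * u i)\<bar> * indicator {..1} (l1_norm d u) +
            ennreal (h (l1_norm d (\<lambda>i. c i + r * u i))) * indicator {..1} (l1_norm d u) \<partial>lebesgue_Rd d)"
      unfolding ball_int_def f_T by (intro nn_integral_add[symmetric]) measurable
    also have "\<dots> = (\<integral>\<^sup>+u. ennreal (\<omega> t) * indicator {..1} (l1_norm d u) \<partial>lebesgue_Rd d)"
      unfolding f_T using h0
      by (intro nn_integral_cong) (simp split: split_indicator flip: ennreal_plus)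
    also have "\<dots> = ennreal (\<omega> t) * ?V"
      using l1_ball_unit_volume[OF d0] by (subst nn_integral_cmult) auto
    also have "\<dots> / ?V = ennreal (\<omega> t)"
      by (rule mult_divide_eq_ennreal[OF unit_volume_pos])
    finally have "?A c r / ?V + ennreal q \<le> ennreal (\<omega> t)" .
    then have "?A c r / ?V \<le> ennreal (\<omega> t - q)"
      using q by (cases "?A c r / ?V") (auto simp: top_unique simp flip: ennreal_plus)
    then show "(\<integral>\<^sup>+z\<in>l1_ball d c r. ennreal \<bar>f z\<bar> \<partial>lebesgue_Rd d) / emeasure (lebesgue_Rd d) (l1_ball d c r)
        \<le> ennreal (\<omega> t - q)"
      unfolding average[OF r] .
  qed
  have norm_f: "lip_norm d \<omega> (\<lambda>x. ereal (f x)) = 1"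
  proof (rule antisym)
    show "lip_norm d \<omega> (\<lambda>x. ereal (f x)) \<le> 1"
    proof (rule lip_norm_least)
      fix x y assume "x \<in> Rd d" "y \<in> Rd d" "x \<noteq> y"
      from modulus_pos[OF \<omega> l1_norm_pos[OF this]] f_lip[of x y]
      show "\<bar>ereal (f x) - ereal (f y)\<bar> / ereal (\<omega> (l1_norm d (\<lambda>i. x i - y i))) \<le> 1"
        by simp
    qed simp
    have "l1_norm d z0 = 0" "l1_norm d z1 = t"
      using d0 t l1_norm_axis_affine[of d 0 t "\<lambda>_. 0"] by (simp_all add: l1_norm_def z0_def z1_def)
    then have "\<bar>f z0 - f z1\<bar> = \<omega> t"
      using t \<omega>t by (simp add: f_def h_def modulus_0[OF \<omega>])
    then show "1 \<le> lip_norm d \<omega> (\<lambda>x. ereal (f x))"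
      using lip_norm_upper[OF z01 \<open>z0 \<noteq> z1\<close> z01(1), of "\<lambda>x. ereal (f x)" \<omega>] \<omega>t
      by (simp add: z01_diff)
  qed
  let ?g = "\<lambda>x. enn2ereal (maximal_fun d f x)"
  obtain b where b: "maximal_fun d f z1 = ennreal b" "0 \<le> b"
    using Mf_le[of z1] by (cases "maximal_fun d f z1") (auto simp: top_unique)
  have a: "maximal_fun d f z0 = ennreal (\<omega> t)"
    using Mf_z0 Mf_le[of z0] by (rule antisym[rotated])
  have "b \<le> \<omega> t - q"
    using Mf_z1 b q by simp
  then have "m * \<omega> t \<le> \<bar>\<omega> t - b\<bar>" by (simp add: q_def)
  then have "ereal m \<le> ereal (\<bar>\<omega> t - b\<bar> / \<omega> t)"
    using \<omega>t by (simp add: pos_le_divide_eq)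
  also have "\<dots> = \<bar>?g z0 - ?g z1\<bar> / ereal (\<omega> (l1_norm d (\<lambda>i. z0 i - z1 i)))"
    unfolding z01_diff using a b \<omega>t by simp
  also have "\<dots> \<le> lip_norm d \<omega> ?g"
    using a by (intro lip_norm_upper[OF z01 \<open>z0 \<noteq> z1\<close> z01(1)]) simp
  also have "\<dots> = lip_norm d \<omega> ?g / lip_norm d \<omega> (\<lambda>x. ereal (f x))"
    unfolding norm_f by simp
  also have "\<dots> \<le> maximal_op_norm d \<omega>"
    unfolding maximal_op_norm_def using norm_f by (intro SUP_upper) (auto simp: Lip_def)
  finally show ?thesis unfolding m(1) .
qed

lemma maximal_op_norm_eq:
  assumes "modulus_of_continuity \<omega>" "2 \<le> d"
  shows "maximal_op_norm d \<omega> = sup_inf_radial \<omega> d"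
proof (rule antisym)
  show "sup_inf_radial \<omega> d \<le> maximal_op_norm d \<omega>"
    unfolding sup_inf_radial_def using assms by (auto intro!: SUP_least maximal_op_norm_ge)
qed (rule maximal_op_norm_le[OF assms])

section \<open>Concentration in high dimension\<close>

text \<open>The slice of the triangle at height \<open>\<rho>\<close> has length
  \<open>2 (1 - \<rho>)\<close>, which leaves a polynomial with antiderivative \<open>?F\<close>.
  Multiplied by \<open>(n + 1) (n + 2) / 2\<close>, the result says that \<open>1 - \<rho>\<close>
  has mean \<open>2 / (n + 3)\<close> under the normalized weight.\<close>

lemma nn_integral_triangle_affine:
  assumes "0 \<le> \<alpha>" "0 \<le> \<beta>"
  shows "(\<integral>\<^sup>+u. \<integral>\<^sup>+\<rho>. ennreal (\<alpha> + \<beta> * (1 - \<rho>)) * ennreal (\<rho> ^ n) * indicator {..1} (\<bar>u\<bar> + \<rho>) *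
      indicator {0..} \<rho> \<partial>lborel \<partial>(lborel :: real measure))
    = ennreal (2 * \<alpha> / (real (n + 1) * real (n + 2)) + 4 * \<beta> / (real (n + 1) * real (n + 2) * real (n + 3)))"
proof -
  let ?k = "\<lambda>\<rho>. (\<alpha> + \<beta> * (1 - \<rho>)) * (2 * (1 - \<rho>)) * \<rho> ^ n"
  let ?F = "\<lambda>\<rho>. 2 * (\<alpha> + \<beta>) * \<rho> ^ (n + 1) / real (n + 1) - 2 * (\<alpha> + 2 * \<beta>) * \<rho> ^ (n + 2) / real (n + 2)
    + 2 * \<beta> * \<rho> ^ (n + 3) / real (n + 3)"
  have "(\<integral>\<^sup>+u. \<integral>\<^sup>+\<rho>. ennreal (\<alpha> + \<beta> * (1 - \<rho>)) * ennreal (\<rho> ^ n) * indicator {..1} (\<bar>u\<bar> + \<rho>) *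
      indicator {0..} \<rho> \<partial>lborel \<partial>(lborel :: real measure)) =
    (\<integral>\<^sup>+\<rho>. \<integral>\<^sup>+u. ennreal (\<alpha> + \<beta> * (1 - \<rho>)) * ennreal (\<rho> ^ n) * indicator {..1} (\<bar>u\<bar> + \<rho>) *
      indicator {0..} \<rho> \<partial>lborel \<partial>lborel)"
    by (rule lborel_pair.Fubini') measurable
  also have "\<dots> = (\<integral>\<^sup>+\<rho>. ennreal (?k \<rho>) * indicator {0..1} \<rho> \<partial>lborel)"
  proof (rule nn_integral_cong)
    fix \<rho> :: real
    have "(\<integral>\<^sup>+u. ennreal (\<alpha> + \<beta> * (1 - \<rho>)) * ennreal (\<rho> ^ n) * indicator {..1} (\<bar>u\<bar> + \<rho>) * indicator {0..} \<rho> \<partial>lborel)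
      = (\<integral>\<^sup>+u. ennreal (\<alpha> + \<beta> * (1 - \<rho>)) * ennreal (\<rho> ^ n) * indicator {0..} \<rho> * indicator {-(1 - \<rho>)..1 - \<rho>} u \<partial>lborel)"
      by (intro nn_integral_cong) (auto split: split_indicator)
    also have "\<dots> = ennreal (\<alpha> + \<beta> * (1 - \<rho>)) * ennreal (\<rho> ^ n) * indicator {0..} \<rho> * emeasure lborel {-(1 - \<rho>)..1 - \<rho>}"
      by (intro nn_integral_cmult_indicator) simp
    also have "\<dots> = ennreal (?k \<rho>) * indicator {0..1} \<rho>"
    proof (cases "\<rho> \<in> {0..1}")
      case True
      then have "emeasure lborel {-(1 - \<rho>)..1 - \<rho>} = ennreal (2 * (1 - \<rho>))"
        by (subst emeasure_lborel_Icc) auto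
      moreover have "ennreal (?k \<rho>) = ennreal (\<alpha> + \<beta> * (1 - \<rho>)) * ennreal (2 * (1 - \<rho>)) * ennreal (\<rho> ^ n)"
        using True assms by (subst ennreal_mult; simp)+
      ultimately show ?thesis using True by (simp add: mult_ac)
    qed (auto split: split_indicator)
    finally show "(\<integral>\<^sup>+u. ennreal (\<alpha> + \<beta> * (1 - \<rho>)) * ennreal (\<rho> ^ n) * indicator {..1} (\<bar>u\<bar> + \<rho>) * indicator {0..} \<rho> \<partial>lborel)
      = ennreal (?k \<rho>) * indicator {0..1} \<rho>" .
  qed
  also have "\<dots> = ennreal (?F 1 - ?F 0)"
  proof (rule nn_integral_FTC_Icc)
    fix \<rho> :: real assume "\<rho> \<in> {0..1}"
    show "(?F has_real_derivative ?k \<rho>) (at \<rho>)"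
    proof -
      have "((\<lambda>\<rho>. c * \<rho> ^ (n + Suc j) / real (n + Suc j)) has_real_derivative c * \<rho> ^ (n + j)) (at \<rho>)" for c j
        by (auto intro!: derivative_eq_intros simp del: of_nat_add of_nat_Suc power_Suc)
      from DERIV_add[OF DERIV_diff[OF this[of "2 * (\<alpha> + \<beta>)" 0] this[of "2 * (\<alpha> + 2 * \<beta>)" 1]] this[of "2 * \<beta>" 2]]
      show ?thesis
        by (simp add: algebra_simps power2_eq_square numeral_2_eq_2 numeral_3_eq_3)
    qed
    show "0 \<le> ?k \<rho>"
      using assms \<open>\<rho> \<in> {0..1}\<close> by (intro mult_nonneg_nonneg add_nonneg_nonneg) auto
  qed auto
  also have "?F 1 - ?F 0 = 2 * \<alpha> / (real (n + 1) * real (n + 2)) + 4 * \<beta> / (real (n + 1) * real (n + 2) * real (n + 3))"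
  proof -
    have zero: "(0::real) ^ (n + 1) = 0" "(0::real) ^ (n + 2) = 0" "(0::real) ^ (n + 3) = 0"
      by simp_all
    have "real (n + 1) \<noteq> 0" "real (n + 2) \<noteq> 0" "real (n + 3) \<noteq> 0" by simp_all
    moreover have "real (n + 2) = real (n + 1) + 1" "real (n + 3) = real (n + 1) + 2" by simp_all
    ultimately show ?thesis
      unfolding zero by (simp add: divide_simps del: of_nat_add) (simp add: algebra_simps)
  qed
  finally show ?thesis .
qed

text \<open>The relative norm \<open>a\<close> on the ball satisfies
  \<open>1 - a \<le> 2 (1 - \<rho>)\<close> for every \<open>R\<close>, and
  \<open>1 - \<rho>\<close> has mean \<open>2 / (d + 1)\<close>. Hence a lower bound for
  \<open>\<omega> (t a)\<close> that is affine in \<open>1 - a\<close> costs at most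
  \<open>e + 4 b / (d + 1)\<close> on average, uniformly in \<open>R\<close>.\<close>

lemma radial_average_ge:
  assumes \<omega>: "modulus_of_continuity \<omega>" and d: "2 \<le> d" and t: "0 < t" and R: "0 \<le> R" "R \<le> 1"
    and e: "0 \<le> e" and b: "0 \<le> b"
    and near: "\<And>a. 0 \<le> a \<Longrightarrow> a \<le> 1 \<Longrightarrow> \<omega> t \<le> \<omega> (t * a) + (e + b * (1 - a))"
  shows "\<omega> t \<le> radial_average \<omega> d t R + (e + 4 * b / (real d + 1))"
proof -
  obtain n where n: "d = n + 2" using d by (metis add.commute le_Suc_ex)
  define X where "X = (LBINT u:{-1..1}. LBINT \<rho>:{0..1 - \<bar>u\<bar>}. \<omega> (t * (\<bar>(1 - R) + R * u\<bar> + R * \<rho>)) * \<rho> ^ n)"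
  define D where "D = real (n + 1) * real (n + 2)"
  have D: "0 < D" by (simp add: D_def add_pos_pos)
  have rad: "radial_average \<omega> d t R = D / 2 * X"
    by (simp add: radial_average_def X_def D_def n mult.commute)
  then have X: "0 \<le> X"
    using radial_average_nonneg[OF \<omega> d t R(1)] D zero_le_mult_iff[of "D / 2" X] by auto
  note [measurable] = extend0_measurable[OF \<omega>]
  let ?W = "\<lambda>u \<rho>. ennreal (extend0 \<omega> (t * (\<bar>(1 - R) + R * u\<bar> + R * \<rho>))) * ennreal (\<rho> ^ n) *
    indicator {..1} (\<bar>u\<bar> + \<rho>) * indicator {0..} \<rho>"
  let ?B = "\<lambda>\<alpha> \<beta> u \<rho>. ennreal (\<alpha> + \<beta> * (1 - \<rho>)) * ennreal (\<rho> ^ n) * indicator {..1} (\<bar>u\<bar> + \<rho>) * indicator {0..} \<rho>"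
  have "?B (\<omega> t) 0 u \<rho> \<le> ?W u \<rho> + ?B e (2 * b) u \<rho>" for u \<rho>
  proof (cases "\<bar>u\<bar> + \<rho> \<le> 1 \<and> 0 \<le> \<rho>")
    case True
    define a where "a = \<bar>(1 - R) + R * u\<bar> + R * \<rho>"
    have a: "0 \<le> a" "a \<le> 1"
      using True R axis_norm_le[OF R, of \<rho> u] by (auto simp: a_def)
    \<comment> \<open>From \<open>a \<ge> (1 - R) - R \<bar>u\<bar> + R \<rho>\<close> follows
      \<open>1 - a \<le> R (1 + \<bar>u\<bar> - \<rho>) \<le> 1 + \<bar>u\<bar> - \<rho>\<close>,
      and \<open>\<bar>u\<bar> \<le> 1 - \<rho>\<close> bounds this by
      \<open>2 (1 - \<rho>)\<close>.\<close>
    have "R * (1 + \<bar>u\<bar> - \<rho>) \<le> 1 * (1 + \<bar>u\<bar> - \<rho>)"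
      using True R by (intro mult_right_mono) auto
    moreover have "(1 - R) - R * \<bar>u\<bar> \<le> \<bar>(1 - R) + R * u\<bar>"
      using abs_ge_minus_self[of u] R mult_left_mono[of "-u" "\<bar>u\<bar>" R] by linarith
    ultimately have "1 - a \<le> 2 * (1 - \<rho>)"
      using True by (simp add: a_def algebra_simps)
    then have "b * (1 - a) \<le> b * (2 * (1 - \<rho>))"
      using b by (intro mult_left_mono)
    then have "\<omega> t \<le> extend0 \<omega> (t * a) + (e + 2 * b * (1 - \<rho>))"
      using near[OF a] t a by (simp add: algebra_simps)
    moreover have "0 \<le> e + 2 * b * (1 - \<rho>)"
      using True e b by (intro add_nonneg_nonneg mult_nonneg_nonneg) auto
    ultimately have "ennreal (\<omega> t) \<le> ennreal (extend0 \<omega> (t * a)) + ennreal (e + 2 * b * (1 - \<rho>))"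
      using extend0_nonneg[OF \<omega>, of "t * a"] ennreal_leI by (metis ennreal_plus)
    then have "ennreal (\<omega> t) * ennreal (\<rho> ^ n) \<le>
        (ennreal (extend0 \<omega> (t * a)) + ennreal (e + 2 * b * (1 - \<rho>))) * ennreal (\<rho> ^ n)"
      by (rule mult_right_mono) simp
    then show ?thesis
      using True by (simp add: a_def distrib_right)
  qed (auto split: split_indicator)
  then have "(\<integral>\<^sup>+u. \<integral>\<^sup>+\<rho>. ?B (\<omega> t) 0 u \<rho> \<partial>lborel \<partial>lborel)
      \<le> (\<integral>\<^sup>+u. \<integral>\<^sup>+\<rho>. ?W u \<rho> + ?B e (2 * b) u \<rho> \<partial>lborel \<partial>lborel)"
    by (intro nn_integral_mono)
  also have "\<dots> = (\<integral>\<^sup>+u. (\<integral>\<^sup>+\<rho>. ?W u \<rho> \<partial>lborel) + (\<integral>\<^sup>+\<rho>. ?B e (2 * b) u \<rho> \<partial>lborel) \<partial>lborel)"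
    by (intro nn_integral_cong nn_integral_add) measurable
  also have "\<dots> = (\<integral>\<^sup>+u. \<integral>\<^sup>+\<rho>. ?W u \<rho> \<partial>lborel \<partial>lborel) + (\<integral>\<^sup>+u. \<integral>\<^sup>+\<rho>. ?B e (2 * b) u \<rho> \<partial>lborel \<partial>lborel)"
    by (intro nn_integral_add) measurable
  finally have "ennreal (2 * \<omega> t / D) \<le> ennreal X + ennreal (2 * e / D + 4 * (2 * b) / (D * real (n + 3)))"
    using b e modulus_pos[OF \<omega> t]
    by (simp only: nn_integral_triangle_affine nn_integral_radial[OF \<omega> t R] X_def[symmetric] D_def[symmetric]
        mult_nonneg_nonneg zero_le_numeral less_imp_le order_refl mult_zero_right div_0 add_0_right)
  moreover have "0 \<le> 2 * e / D + 4 * (2 * b) / (D * real (n + 3))"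
    using e b D by simp
  ultimately have "2 * \<omega> t / D \<le> X + (2 * e / D + 4 * (2 * b) / (D * real (n + 3)))"
    using X by (simp flip: ennreal_plus)
  then have "D / 2 * (2 * \<omega> t / D) \<le> D / 2 * (X + (2 * e / D + 4 * (2 * b) / (D * real (n + 3))))"
    using D by (intro mult_left_mono) auto
  moreover have "D / 2 * (X + (2 * e / D + 4 * (2 * b) / (D * N))) = D / 2 * X + (e + 4 * b / N)" for N
    using D by (simp add: distrib_left)
  ultimately have "\<omega> t \<le> D / 2 * X + (e + 4 * b / real (n + 3))"
    using D by (simp only:) simp
  moreover have "real (n + 3) = real d + 1" by (simp add: n)
  ultimately show ?thesis
    unfolding rad by (simp only:)
qed

text \<open>The supremum over \<open>t\<close> is bounded below by its term at \<open>t = 1\<close>,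
  so continuity of \<open>\<omega>\<close> at the single point 1 is enough; no uniformity in
  \<open>t\<close> is required.\<close>

lemma sup_inf_radial_ge:
  assumes \<omega>: "modulus_of_continuity \<omega>" and e: "0 < e"
  shows "\<forall>\<^sub>F d in sequentially. ereal (1 - e) \<le> sup_inf_radial \<omega> d"
proof -
  have \<omega>1: "0 < \<omega> 1" by (rule modulus_pos[OF \<omega>]) simp
  have "isCont (extend0 \<omega>) 1"
    using continuous_extend0[OF \<omega>] by (simp add: continuous_on_eq_continuous_at)
  moreover have "0 < e / 2 * \<omega> 1" using e \<omega>1 by simp
  ultimately obtain \<delta> where \<delta>: "0 < \<delta>"
    "\<And>x. \<bar>x - 1\<bar> < \<delta> \<Longrightarrow> \<bar>extend0 \<omega> x - extend0 \<omega> 1\<bar> < e / 2 * \<omega> 1"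
    unfolding continuous_at_eps_delta dist_real_def by blast
  \<comment> \<open>Within distance \<open>\<delta>\<close> of 1 continuity bounds the loss by
    \<open>e / 2 * \<omega> 1\<close>. Further away the slope \<open>\<omega> 1 / \<delta>\<close>
    makes the linear term alone at least \<open>\<omega> 1\<close>.\<close>
  have near: "\<omega> 1 \<le> \<omega> (1 * a) + (e / 2 * \<omega> 1 + \<omega> 1 / \<delta> * (1 - a))" if "0 \<le> a" "a \<le> 1" for a
  proof (cases "1 - a < \<delta>")
    case True
    have "0 \<le> \<omega> 1 / \<delta> * (1 - a)" using \<omega>1 \<delta> that by simp
    moreover have "\<bar>\<omega> a - \<omega> 1\<bar> < e / 2 * \<omega> 1"
      using \<delta>(2)[of a] True that by simp
    ultimately show ?thesis unfolding mult_1 by linarith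
  next
    case False
    have "\<omega> 1 / \<delta> * \<delta> \<le> \<omega> 1 / \<delta> * (1 - a)"
      using False \<omega>1 \<delta> by (intro mult_left_mono) auto
    then have "\<omega> 1 \<le> \<omega> 1 / \<delta> * (1 - a)" using \<delta>(1) by simp
    moreover have "0 \<le> e / 2 * \<omega> 1" using e \<omega>1 by simp
    ultimately show ?thesis
      using modulus_nonneg[OF \<omega>, of a] that unfolding mult_1 by linarith
  qed
  \<comment> \<open>The threshold makes the error \<open>4 b / (d + 1)\<close> with
    \<open>b = \<omega> 1 / \<delta>\<close> at most \<open>e / 2 * \<omega> 1\<close>, the other
    half of the allowed loss.\<close>
  have "\<forall>\<^sub>F d :: nat in sequentially. 8 / (e * \<delta>) < real d"
    by (rule eventually_gt_at_top[THEN filterlim_real_sequentially[unfolded filterlim_iff, rule_format]])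
  with eventually_ge_at_top[of 2] show ?thesis
  proof eventually_elim
    case (elim d)
    have "8 < real d * (e * \<delta>)"
      using elim e \<delta>(1) by (simp add: pos_divide_less_eq)
    moreover have "0 < e * \<delta>" using e \<delta>(1) by simp
    ultimately have "8 \<le> (real d + 1) * (e * \<delta>)"
      unfolding distrib_right mult_1 by linarith
    then have small: "4 / (\<delta> * (real d + 1)) \<le> e / 2"
      using e \<delta>(1) by (simp add: divide_simps) (simp add: mult_ac)
    have "ereal (1 - e) \<le> (INF R\<in>{1/2..1}. ereal (radial_average \<omega> d 1 R / \<omega> 1))"
    proof (rule INF_greatest)
      fix R :: real assume "R \<in> {1/2..1}"
      then have "\<omega> 1 \<le> radial_average \<omega> d 1 R + (e / 2 * \<omega> 1 + 4 * (\<omega> 1 / \<delta>) / (real d + 1))"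
        using e \<omega>1 \<delta>(1) elim near by (intro radial_average_ge[OF \<omega>]) auto
      also have "4 * (\<omega> 1 / \<delta>) / (real d + 1) = 4 / (\<delta> * (real d + 1)) * \<omega> 1"
        by simp
      also have "\<dots> \<le> e / 2 * \<omega> 1"
        using small \<omega>1 by (intro mult_right_mono) auto
      finally have "(1 - e) * \<omega> 1 \<le> radial_average \<omega> d 1 R"
        by (simp add: algebra_simps)
      then show "ereal (1 - e) \<le> ereal (radial_average \<omega> d 1 R / \<omega> 1)"
        using \<omega>1 by (simp add: pos_le_divide_eq)
    qed
    also have "\<dots> \<le> sup_inf_radial \<omega> d"
      unfolding sup_inf_radial_def by (intro SUP_upper) simp
    finally show ?case .
  qed
qed

theorem theorem3p16:
  fixes \<omega> :: "real \<Rightarrow> real"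
  assumes "modulus_of_continuity \<omega>"
  shows "(\<forall>d::nat. d \<ge> 2 \<longrightarrow>
            maximal_op_norm d \<omega> =
              (SUP t \<in> {0<..}. INF R \<in> {1/2..1}.
                 ereal (real d * (real d - 1) / (2 * \<omega> t) *
                   (LBINT u:{-1..1}. LBINT \<rho>:{0..1 - \<bar>u\<bar>}.
                      \<omega> (t * (\<bar>(1 - R) + R * u\<bar> + R * \<rho>)) * \<rho> ^ (d - 2)))))
         \<and> (\<lambda>d. maximal_op_norm d \<omega>) \<longlonglongrightarrow> 1"
proof (intro conjI allI impI)
  fix d :: nat assume d: "2 \<le> d"
  have "real d * (real d - 1) / (2 * \<omega> t) * X = real d * (real d - 1) / 2 * X / \<omega> t" for t X
    by simp
  then show "maximal_op_norm d \<omega> =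
      (SUP t \<in> {0<..}. INF R \<in> {1/2..1}.
         ereal (real d * (real d - 1) / (2 * \<omega> t) *
           (LBINT u:{-1..1}. LBINT \<rho>:{0..1 - \<bar>u\<bar>}.
              \<omega> (t * (\<bar>(1 - R) + R * u\<bar> + R * \<rho>)) * \<rho> ^ (d - 2))))"
    unfolding maximal_op_norm_eq[OF assms d] sup_inf_radial_def radial_average_def by (simp only:)
next
  show "(\<lambda>d. maximal_op_norm d \<omega>) \<longlonglongrightarrow> 1"
  proof (rule order_tendstoI)
    fix a :: ereal assume "a < 1"
    then obtain x where x: "a < ereal x" "ereal x < 1"
      using ereal_dense2 by blast
    then have "0 < 1 - x" by simp
    from sup_inf_radial_ge[OF assms this] eventually_ge_at_top[of 2]
    show "\<forall>\<^sub>F d in sequentially. a < maximal_op_norm d \<omega>"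
    proof eventually_elim
      case (elim d)
      then show ?case
        using x(1) by (simp add: maximal_op_norm_eq[OF assms])
    qed
  next
    fix a :: ereal assume a: "1 < a"
    \<comment> \<open>The bound by 1 holds in every dimension \<open>d \<ge> 2\<close>;
      concentration is needed only from below.\<close>
    show "\<forall>\<^sub>F d in sequentially. maximal_op_norm d \<omega> < a"
      using eventually_ge_at_top[of 2]
      by eventually_elim (metis a maximal_op_norm_eq[OF assms] sup_inf_radial_le_1[OF assms] le_less_trans)
  qed
qed

end
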